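(* Let $n,p,q$ be positive integers with $p\ge 2$, let $\gamma$ be a real, and let $\epsilon_1>0$. Let $C\ge\sigma^2_{\max}\lambda_{\max}$, $\kappa=\log_n p$ and $\gamma_0=\gamma-\left(1-\frac{1}{4\kappa}\right)$. Suppose $$\frac{(p+2q)\log p}{n}\cdot\frac{\lambda_{\max}^2}{\theta_0^2}\le\frac{1}{3200\max\{1+\gamma_0,(1+\frac{\epsilon_1}{2})C^2\}}.$$ Then with probability at least $1-\frac{1}{\sqrt{\pi\log p}}p^{-\epsilon_1}$, for all edge sets $\mathbf{E}$ on the $p$ nodes with $\mathbf{E}\not\supset\mathbf{E}_0$ and $|\mathbf{E}|\le q$, $$l_n(\Theta_0)-l_n(\hat\Theta(\mathbf{E}))>2q(\log p)(1+\gamma_0).$$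
   Context: An edge set $\mathbf{E}$ on $p$ nodes is a set of unordered pairs $\{j,k\}$ of distinct elements of $\{1,\dots,p\}$; it is identified with the Gaussian graphical model of all zero-mean normal distributions $N(0,\Theta^{-1})$ with $\Theta$ positive definite and $\Theta_{jk}=0$ whenever $j\neq k$ and $\{j,k\}\notin\mathbf{E}$. Let $\mathbf{E}_0$ be an edge set and $\Theta_0$ a $p\times p$ positive definite matrix whose nonzero entries are exactly the diagonal entries and the entries $(j,k),(k,j)$ for $\{j,k\}\in\mathbf{E}_0$. Let $X_1,\dots,X_n$ be i.i.d. $N(0,\Theta_0^{-1})$, $S=\frac1n\sum_i X_iX_i^T$, and $l_n(\Theta)=\frac n2[\log\det\Theta-\mathrm{trace}(S\Theta)]$. $\hat\Theta(\mathbf{E})$ denotes the maximum likelihood estimator of $\Theta$ in the model $\mathbf{E}$. Further, $\sigma^2_{\max}=\max_j(\Theta_0^{-1})_{jj}$, $\theta_0=\min_{\{j,k\}\in\mathbf{E}_0}|(\Theta_0)_{jk}|$, and $\lambda_{\max}$ is the largest eigenvalue of $\Theta_0$. *)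

theory Defs
  imports "HOL-Probability.Probability"
begin

text \<open>Nodes of the graph are the elements of a finite type 'n with CARD('n) = p;
  p x p matrices are real^'n^'n.\<close>

definition pos_def_mat :: "real^'n^'n \<Rightarrow> bool" where
  "pos_def_mat A \<longleftrightarrow> transpose A = A \<and> (\<forall>x. x \<noteq> 0 \<longrightarrow> x \<bullet> (A *v x) > 0)"

definition edge_set :: "'n set set \<Rightarrow> bool" where
  "edge_set E \<longleftrightarrow> (\<forall>e\<in>E. \<exists>j k. j \<noteq> k \<and> e = {j, k})"

text \<open>The Gaussian graphical model of an edge set (as a set of precision matrices).\<close>
definition in_model :: "'n set set \<Rightarrow> real^'n^'n \<Rightarrow> bool" where
  "in_model E Th \<longleftrightarrow> pos_def_mat Th \<and> (\<forall>j k. j \<noteq> k \<and> {j, k} \<notin> E \<longrightarrow> Th $ j $ k = 0)"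

definition is_eigenvalue :: "real^'n^'n \<Rightarrow> real \<Rightarrow> bool" where
  "is_eigenvalue A l \<longleftrightarrow> (\<exists>v. v \<noteq> 0 \<and> A *v v = l *\<^sub>R v)"

definition lambda_max :: "real^'n^'n \<Rightarrow> real" where
  "lambda_max A = Max {l. is_eigenvalue A l}"

definition sigma2_max :: "real^'n^'n \<Rightarrow> real" where
  "sigma2_max Th = Max (range (\<lambda>j. matrix_inv Th $ j $ j))"

definition theta_min :: "'n set set \<Rightarrow> real^'n^'n \<Rightarrow> real" where
  "theta_min E Th = Min {\<bar>Th $ j $ k\<bar> | j k. {j, k} \<in> E}"

definition mvnormal_prec :: "real^'n^'n \<Rightarrow> (real^'n) measure" where
  "mvnormal_prec Th = density lborel
     (\<lambda>x. ennreal ((2 * pi) powr (- real CARD('n) / 2) * sqrt (det Th)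
                    * exp (- (x \<bullet> (Th *v x)) / 2)))"

definition sample_law :: "nat \<Rightarrow> real^'n^'n \<Rightarrow> (nat \<Rightarrow> real^'n) measure" where
  "sample_law n Th = PiM {..<n} (\<lambda>_. mvnormal_prec Th)"

definition sample_cov :: "nat \<Rightarrow> (nat \<Rightarrow> real^'n) \<Rightarrow> real^'n^'n" where
  "sample_cov n X = (1 / real n) *\<^sub>R (\<Sum>i<n. (\<chi> j k. X i $ j * X i $ k))"

definition loglik :: "nat \<Rightarrow> real^'n^'n \<Rightarrow> real^'n^'n \<Rightarrow> real" where
  "loglik n S Th = real n / 2 * (ln (det Th) - trace (S ** Th))"

text \<open>Value of the log-likelihood at the MLE of the model E, i.e. the supremum of
  the log-likelihood over the model (taken in the extended reals).\<close>
definition loglik_mle :: "nat \<Rightarrow> real^'n^'n \<Rightarrow> 'n set set \<Rightarrow> ereal" where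
  "loglik_mle n S E = (SUP Th\<in>{Th. in_model E Th}. ereal (loglik n S Th))"

end

theory Submission
  imports Defs
begin

text \<open>
  Write \<open>\<Sigma>\<close> for the inverse of \<open>\<Theta>\<^sub>0\<close>, \<open>\<Delta> = \<Theta> - \<Theta>\<^sub>0\<close>, and \<open>x\<close> for the Frobenius norm of
  \<open>M = \<Sigma>\<^sup>1\<^sup>/\<^sup>2 \<Delta> \<Sigma>\<^sup>1\<^sup>/\<^sup>2\<close>. The log-likelihood gap is \<open>n/2\<close> times the sum of the divergence
  \<open>\<Sum>\<^sub>i (\<mu>\<^sub>i - ln (1 + \<mu>\<^sub>i)) \<ge> x\<^sup>2 / (2 (1 + x))\<close> over the eigenvalues of \<open>M\<close> and the noise term
  \<open>trace ((S - \<Sigma>) \<Delta>)\<close>. The Frobenius norm of \<open>\<Delta>\<close> is at most \<open>\<lambda>\<^sub>m\<^sub>a\<^sub>x x\<close>, and \<open>\<Delta>\<close> is supported on at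
  most \<open>p + 2q + N\<close> entries, where \<open>N\<close> counts the missed edges as ordered pairs. The
  possibly large \<open>N\<close> is harmless because \<open>N \<theta>\<^sub>0\<^sup>2\<close> is at most both the squared norm of \<open>\<Delta>\<close> and that of
  \<open>\<Theta>\<^sub>0\<close>; hence the signal beats the noise as soon as the entries of \<open>S - \<Sigma>\<close> are uniformly small.

  For the latter, polarization reduces the entries of \<open>S\<close> to the empirical second moments along
  \<open>e\<^sub>j \<plusminus> e\<^sub>k\<close>. Their exponential moments are Gaussian integrals with precision matrix
  \<open>\<Theta>\<^sub>0 - 2s u u\<^sup>T\<close>, so a Chernoff bound and a union bound over \<open>2p\<^sup>2\<close> directions suffice.
\<close>

section \<open>Spectral decomposition of symmetric matrices\<close>

text \<open>First-order optimality: moving from \<open>v\<close> to \<open>v + t *\<^sub>R w\<close>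
  along the residual \<open>w\<close> would raise the Rayleigh quotient at rate
  \<open>2 * t * (w \<bullet> w)\<close>, while everything else is of order \<open>t\<close>
  squared. Hence the residual vanishes.\<close>

lemma rayleigh_maximizer_eigenvector:
  fixes A :: "real^'n^'n"
  assumes sym: "transpose A = A" and V: "subspace V" and AV: "\<And>x. x \<in> V \<Longrightarrow> A *v x \<in> V"
    and v: "v \<in> V" "norm v = 1"
    and max: "\<And>y. y \<in> V \<Longrightarrow> y \<bullet> (A *v y) \<le> l * (y \<bullet> y)"
    and l: "l = v \<bullet> (A *v v)"
  shows "A *v v = l *\<^sub>R v"
proof -
  define w where "w = A *v v - l *\<^sub>R v"
  have wV: "w \<in> V" unfolding w_def
    by (intro subspace_diff V AV v subspace_scale)
  have vv: "v \<bullet> v = 1" using v(2) by (simp add: dot_square_norm)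
  have "v \<bullet> w = 0" unfolding w_def l
    by (simp add: inner_diff_right vv)
  then have wv: "w \<bullet> v = 0" by (simp add: inner_commute)
  have ww: "w \<bullet> (A *v v) = w \<bullet> w"
  proof -
    have "A *v v = w + l *\<^sub>R v" by (simp add: w_def)
    then show ?thesis by (simp add: inner_add_right wv)
  qed
  have comm: "v \<bullet> (A *v w) = w \<bullet> (A *v v)"
    by (metis dot_lmul_matrix inner_commute sym transpose_matrix_vector)
  have key: "2 * t * (w \<bullet> w) \<le> t\<^sup>2 * (l * (w \<bullet> w) - w \<bullet> (A *v w))" for t
  proof -
    have "(v + t *\<^sub>R w) \<in> V" by (intro subspace_add V v subspace_scale wV)
    from max[OF this] show ?thesis
      using wv vv l ww comm
      by (simp add: matrix_vector_right_distrib matrix_vector_mult_scaleR inner_add_left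
          inner_add_right inner_commute[of v w] power2_eq_square algebra_simps)
  qed
  have "w \<bullet> w = 0"
  proof (rule ccontr)
    assume "w \<bullet> w \<noteq> 0"
    then have pos: "w \<bullet> w > 0" by (simp add: order_less_le)
    define c where "c = \<bar>l * (w \<bullet> w) - w \<bullet> (A *v w)\<bar> + 1"
    have c: "c > 0" "l * (w \<bullet> w) - w \<bullet> (A *v w) \<le> c" by (auto simp: c_def)
    \<comment> \<open>At this \<open>t\<close> the quadratic term is at most
      \<open>t * (w \<bullet> w)\<close>, half of the linear one; the \<open>+ 1\<close> in
      \<open>c\<close> keeps the quotient well defined.\<close>
    define t where "t = (w \<bullet> w) / c"
    have t: "t > 0" using pos c by (simp add: t_def)
    have "2 * t * (w \<bullet> w) \<le> t\<^sup>2 * c"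
      using key[of t] c(2) by (meson mult_left_mono order_trans zero_le_power2)
    also have "\<dots> = t * (w \<bullet> w)" using c by (simp add: t_def power2_eq_square)
    finally show False using t pos by (simp add: mult_le_cancel_right)
  qed
  then show ?thesis by (simp add: w_def)
qed

text \<open>Stated for invariant subspaces so that induction on the dimension works: a maximizer of
  the quadratic form on the compact unit sphere of \<open>V\<close> is an eigenvector, and by
  symmetry its orthogonal complement in \<open>V\<close> is again invariant and of smaller
  dimension.\<close>

lemma orthonormal_eigenbasis_subspace:
  fixes A :: "real^'n^'n"
  assumes sym: "transpose A = A"
  shows "subspace V \<Longrightarrow> (\<And>x. x \<in> V \<Longrightarrow> A *v x \<in> V) \<Longrightarrow>
    \<exists>B. pairwise orthogonal B \<and> (\<forall>b\<in>B. norm b = 1 \<and> (\<exists>l. A *v b = l *\<^sub>R b)) \<and> span B = V"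
proof (induction "dim V" arbitrary: V rule: less_induct)
  case less
  note V = less.prems
  show ?case
  proof (cases "V = {0}")
    case True
    then show ?thesis by (intro exI[of _ "{}"]) auto
  next
    case False
    then obtain z where z: "z \<in> V" "z \<noteq> 0" using subspace_0[OF V(1)] by auto
    define K where "K = V \<inter> sphere 0 1"
    have "compact K" unfolding K_def
      using closed_subspace[OF V(1)] by (simp add: closed_Int_compact)
    moreover have "z /\<^sub>R norm z \<in> K"
      using z V(1) by (auto simp: K_def subspace_scale)
    then have "K \<noteq> {}" by auto
    moreover have "continuous_on K (\<lambda>x. x \<bullet> (A *v x))"
      by (intro continuous_intros linear_continuous_on_compose[OF _ matrix_vector_mul_linear])
    ultimately obtain v where v: "v \<in> K" "\<And>y. y \<in> K \<Longrightarrow> y \<bullet> (A *v y) \<le> v \<bullet> (A *v v)"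
      using continuous_attains_sup by metis
    define l where "l = v \<bullet> (A *v v)"
    have vn: "v \<in> V" "norm v = 1" using v(1) by (auto simp: K_def)
    have max: "y \<bullet> (A *v y) \<le> l * (y \<bullet> y)" if "y \<in> V" for y
    proof (cases "y = 0")
      case False
      have "(y /\<^sub>R norm y) \<in> K" using that False V(1) by (auto simp: K_def subspace_scale)
      from v(2)[OF this] have "(y \<bullet> (A *v y)) / (norm y)\<^sup>2 \<le> l"
        by (simp add: l_def matrix_vector_mult_scaleR power2_eq_square divide_inverse mult_ac)
      then show ?thesis using False by (simp add: dot_square_norm divide_le_eq)
    qed auto
    have Av: "A *v v = l *\<^sub>R v"
      by (rule rayleigh_maximizer_eigenvector[OF sym V vn max l_def])
    define W where "W = V \<inter> {y. orthogonal v y}"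
    have W: "subspace W" unfolding W_def
      by (intro subspace_inter V(1) subspace_orthogonal_to_vector)
    have AW: "A *v x \<in> W" if "x \<in> W" for x
    proof -
      have "v \<bullet> (A *v x) = (A *v v) \<bullet> x"
        by (metis dot_lmul_matrix sym transpose_matrix_vector)
      then show ?thesis using that V(2)
        by (auto simp: W_def orthogonal_def Av)
    qed
    have "v \<notin> W" using vn by (auto simp: W_def orthogonal_def)
    then have "W \<subset> V" using vn by (auto simp: W_def)
    then have "dim W < dim V"
      using W V(1) by (metis dim_psubset span_eq_iff)
    from less.hyps[OF this W AW] obtain B where B: "pairwise orthogonal B"
      "\<forall>b\<in>B. norm b = 1 \<and> (\<exists>l. A *v b = l *\<^sub>R b)" "span B = W" by blast
    have BW: "B \<subseteq> W" using B(3) span_superset by blast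
    have "pairwise orthogonal (insert v B)"
      using B(1) BW by (auto simp: pairwise_insert W_def orthogonal_commute)
    moreover have "\<forall>b\<in>insert v B. norm b = 1 \<and> (\<exists>l. A *v b = l *\<^sub>R b)"
      using B(2) vn Av by auto
    moreover have "span (insert v B) = V"
    proof
      show "span (insert v B) \<subseteq> V"
        by (rule span_minimal) (use vn BW V(1) in \<open>auto simp: W_def\<close>)
      show "V \<subseteq> span (insert v B)"
      proof
        fix x assume x: "x \<in> V"
        have "x - (v \<bullet> x) *\<^sub>R v \<in> W"
          using x vn V(1)
          by (auto simp: W_def orthogonal_def inner_diff_right dot_square_norm subspace_diff subspace_scale)
        then have "x - (v \<bullet> x) *\<^sub>R v \<in> span (insert v B)"
          using B(3) span_mono[of B "insert v B"] by auto
        moreover have "(v \<bullet> x) *\<^sub>R v \<in> span (insert v B)"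
          by (intro span_scale span_base) auto
        ultimately show "x \<in> span (insert v B)"
          using span_add by fastforce
      qed
    qed
    ultimately show ?thesis by blast
  qed
qed

section \<open>Diagonal matrices and orthogonal diagonalization\<close>

definition diag_mat :: "('n \<Rightarrow> real) \<Rightarrow> real^'n^'n" where
  "diag_mat d = (\<chi> i j. if i = j then d i else 0)"

lemma diag_mat_nth [simp]: "diag_mat d $ i $ j = (if i = j then d i else 0)"
  by (simp add: diag_mat_def)

lemma transpose_diag_mat [simp]: "transpose (diag_mat d) = diag_mat d"
  by (simp add: transpose_def vec_eq_iff)

lemma diag_mat_mult [simp]: "diag_mat d ** diag_mat e = diag_mat (\<lambda>i. d i * e i)"
  by (auto simp: matrix_matrix_mult_def vec_eq_iff mult_delta_left mult_delta_right)

lemma diag_mat_vec: "diag_mat d *v x = (\<chi> i. d i * x $ i)"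
  by (simp add: matrix_vector_mult_def vec_eq_iff mult_delta_left)

lemma diag_mat_one: "diag_mat (\<lambda>i. 1) = mat 1"
  by (simp add: vec_eq_iff mat_def)

lemma diag_mat_add: "diag_mat d + diag_mat e = diag_mat (\<lambda>i. d i + e i)"
  by (simp add: vec_eq_iff)

lemma det_diag_mat [simp]: "det (diag_mat d) = (\<Prod>i\<in>UNIV. d i)"
  by (subst det_diagonal) auto

lemma trace_diag_mat [simp]: "trace (diag_mat d) = (\<Sum>i\<in>UNIV. d i)"
  by (simp add: trace_def)

theorem symmetric_diagonalizable:
  fixes A :: "real^'n^'n"
  assumes sym: "transpose A = A"
  obtains Q d where "orthogonal_matrix Q" "A = Q ** diag_mat d ** transpose Q"
proof -
  obtain B where B: "pairwise orthogonal B"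
      "\<forall>b\<in>B. norm b = 1 \<and> (\<exists>l. A *v b = l *\<^sub>R b)" "span B = UNIV"
    using orthonormal_eigenbasis_subspace[OF sym subspace_UNIV] by auto
  have ind: "independent B"
    using B(1,2) by (intro pairwise_orthogonal_independent) auto
  have fin: "finite B" and cB: "card B = CARD('n)"
    using ind B(3) independent_imp_finite dim_span_eq_card_independent[OF ind] by auto
  \<comment> \<open>The eigenbasis has exactly \<open>CARD('n)\<close> elements, so it can be
    indexed by the node type itself and become the columns of \<open>Q\<close>.\<close>
  obtain f :: "'n \<Rightarrow> real^'n" where f: "bij_betw f UNIV B"
    using finite_same_card_bij[of "UNIV :: 'n set" B] fin cB by auto
  have fB: "f i \<in> B" for i using f by (auto simp: bij_betw_def)
  have "\<forall>i. \<exists>l. A *v f i = l *\<^sub>R f i" using B(2) fB by blast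
  then have "\<exists>d. \<forall>i. A *v f i = d i *\<^sub>R f i" by (rule choice)
  then obtain d where d: "\<And>i. A *v f i = d i *\<^sub>R f i" by auto
  have on: "f i \<bullet> f j = (if i = j then 1 else 0)" for i j
  proof (cases "i = j")
    case True
    then show ?thesis using B(2) fB[of i] by (simp add: dot_square_norm)
  next
    case False
    then have "f i \<noteq> f j" using f by (auto simp: bij_betw_def inj_on_def)
    then show ?thesis using B(1) fB[of i] fB[of j] False
      by (auto simp: pairwise_def orthogonal_def)
  qed
  define Q :: "real^'n^'n" where "Q = (\<chi> i j. f j $ i)"
  have Q: "orthogonal_matrix Q"
    unfolding orthogonal_matrix
    using on by (simp add: matrix_matrix_mult_def Q_def transpose_def vec_eq_iff mat_def inner_vec_def)
  have "(A ** Q) $ i $ j = (Q ** diag_mat d) $ i $ j" for i j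
  proof -
    have "(A ** Q) $ i $ j = (A *v f j) $ i"
      by (simp add: matrix_matrix_mult_def matrix_vector_mult_def Q_def)
    also have "\<dots> = (Q ** diag_mat d) $ i $ j"
      by (simp add: d matrix_matrix_mult_def Q_def mult_delta_right)
    finally show ?thesis .
  qed
  then have "A ** Q = Q ** diag_mat d" by (simp add: vec_eq_iff)
  then have "A ** (Q ** transpose Q) = Q ** diag_mat d ** transpose Q"
    by (simp add: matrix_mul_assoc)
  then have "A = Q ** diag_mat d ** transpose Q"
    using Q by (simp add: orthogonal_matrix_def)
  with Q show ?thesis by (rule that)
qed

section \<open>Positive definite matrices\<close>

lemma inner_matrix_adjoint:
  fixes A :: "real^'n^'m"
  shows "x \<bullet> (A *v y) = (transpose A *v x) \<bullet> y"
  by (simp add: dot_lmul_matrix)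

lemma inner_symmetric_matrix:
  fixes A :: "real^'n^'n"
  assumes "transpose A = A"
  shows "x \<bullet> (A *v y) = (A *v x) \<bullet> y"
  using inner_matrix_adjoint[of x A y] assms by simp

lemma orthogonal_matrix_inner:
  fixes Q :: "real^'n^'n"
  assumes "orthogonal_matrix Q"
  shows "(Q *v x) \<bullet> (Q *v y) = x \<bullet> y"
proof -
  have "(Q *v x) \<bullet> (Q *v y) = (transpose Q *v (Q *v x)) \<bullet> y"
    by (rule inner_matrix_adjoint)
  also have "\<dots> = x \<bullet> y"
    using assms unfolding matrix_vector_mul_assoc orthogonal_matrix by simp
  finally show ?thesis .
qed

lemma orthogonal_matrix_cancel:
  fixes Q :: "real^'n^'n"
  assumes "orthogonal_matrix Q"
  shows "transpose Q *v (Q *v x) = x" "Q *v (transpose Q *v x) = x"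
  using assms unfolding matrix_vector_mul_assoc orthogonal_matrix_def by simp_all

lemma quadratic_form_diagonalized:
  fixes Q :: "real^'n^'n"
  shows "x \<bullet> ((Q ** diag_mat d ** transpose Q) *v x) = (\<Sum>i\<in>UNIV. d i * ((transpose Q *v x) $ i)\<^sup>2)"
proof -
  have "x \<bullet> ((Q ** diag_mat d ** transpose Q) *v x)
      = (transpose Q *v x) \<bullet> (diag_mat d *v (transpose Q *v x))"
    unfolding matrix_vector_mul_assoc[symmetric] by (rule inner_matrix_adjoint)
  also have "\<dots> = (\<Sum>i\<in>UNIV. d i * ((transpose Q *v x) $ i)\<^sup>2)"
    unfolding diag_mat_vec inner_vec_def
    by (intro sum.cong) (auto simp: power2_eq_square)
  finally show ?thesis .
qed

lemma det_orthogonal_conj: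
  fixes Q B :: "real^'n^'n"
  assumes "orthogonal_matrix Q"
  shows "det (Q ** B ** transpose Q) = det B"
proof -
  have "det Q * det Q = 1"
    using det_orthogonal_matrix[OF assms] by auto
  then show ?thesis by (simp add: det_mul)
qed

lemma pos_def_mat_diagonalizable:
  fixes A :: "real^'n^'n"
  assumes "pos_def_mat A"
  obtains Q d where "orthogonal_matrix Q" "A = Q ** diag_mat d ** transpose Q" "\<And>i. d i > 0"
proof -
  have "transpose A = A" using assms by (simp add: pos_def_mat_def)
  then obtain Q d where Q: "orthogonal_matrix Q" and A: "A = Q ** diag_mat d ** transpose Q"
    by (rule symmetric_diagonalizable)
  have "d i > 0" for i
  proof -
    define x where "x = Q *v axis i 1"
    have x: "transpose Q *v x = axis i 1"
      unfolding x_def by (rule orthogonal_matrix_cancel[OF Q])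
    have "x \<noteq> 0"
    proof
      assume "x = 0"
      then have "axis i (1::real) = 0" using x by simp
      then show False by (simp add: axis_eq_0_iff)
    qed
    then have "0 < x \<bullet> (A *v x)" using assms by (simp add: pos_def_mat_def)
    also have "\<dots> = (\<Sum>k\<in>UNIV. if k = i then d i else 0)"
      unfolding A quadratic_form_diagonalized x by (intro sum.cong) (auto simp: axis_def)
    finally show ?thesis by simp
  qed
  with Q A show ?thesis by (rule that)
qed

lemma det_pos_def:
  assumes "pos_def_mat A"
  shows "det A > 0"
proof -
  obtain Q d where Q: "orthogonal_matrix Q" and A: "A = Q ** diag_mat d ** transpose Q"
    and d: "\<And>i. d i > 0" using pos_def_mat_diagonalizable[OF assms] by blast
  show ?thesis using d by (simp only: A det_orthogonal_conj[OF Q]) (simp add: prod_pos)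
qed

text \<open>The symmetric root turns statements about \<open>A\<close> into statements about the
  identity by congruence; it is the working tool for all later bounds.\<close>

lemma pos_def_mat_sqrt:
  fixes A :: "real^'n^'n"
  assumes "pos_def_mat A"
  obtains R where "transpose R = R" "R ** R = A" "invertible R"
proof -
  obtain Q d where Q: "orthogonal_matrix Q" and A: "A = Q ** diag_mat d ** transpose Q"
    and d: "\<And>i. d i > 0" using pos_def_mat_diagonalizable[OF assms] by blast
  define R where "R = Q ** diag_mat (\<lambda>i. sqrt (d i)) ** transpose Q"
  have "transpose R = R" by (simp add: R_def matrix_transpose_mul matrix_mul_assoc)
  moreover have RR: "R ** R = A"
  proof -
    have "R ** R = Q ** diag_mat (\<lambda>i. sqrt (d i)) ** (transpose Q ** Q) ** diag_mat (\<lambda>i. sqrt (d i)) ** transpose Q"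
      by (simp only: R_def matrix_mul_assoc)
    also have "\<dots> = Q ** (diag_mat (\<lambda>i. sqrt (d i)) ** diag_mat (\<lambda>i. sqrt (d i))) ** transpose Q"
      using Q by (simp add: orthogonal_matrix matrix_mul_assoc del: diag_mat_mult)
    also have "\<dots> = A" using d by (simp add: A order_less_imp_le)
    finally show ?thesis .
  qed
  moreover have "invertible R"
    using det_pos_def[OF assms] by (auto simp: invertible_det_nz RR[symmetric] det_mul)
  ultimately show ?thesis by (rule that)
qed

lemma matrix_inv:
  fixes A :: "real^'n^'n"
  assumes "invertible A"
  shows "A ** matrix_inv A = mat 1" "matrix_inv A ** A = mat 1"
proof -
  have "\<exists>B. A ** B = mat 1 \<and> B ** A = mat 1" using assms by (simp add: invertible_def)
  from someI_ex[OF this] show "A ** matrix_inv A = mat 1" "matrix_inv A ** A = mat 1"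
    by (simp_all add: matrix_inv_def)
qed

lemma matrix_inv_unique:
  fixes A :: "real^'n^'n"
  assumes "A ** B = mat 1"
  shows "matrix_inv A = B"
proof -
  have "B ** A = mat 1" using assms by (simp add: matrix_left_right_inverse)
  then have "invertible A" using assms by (auto simp: invertible_def)
  then have "matrix_inv A ** A ** B = B" by (simp add: matrix_inv)
  then show ?thesis by (simp add: matrix_mul_assoc[symmetric] assms)
qed

lemma matrix_inv_sqrt:
  fixes R :: "real^'n^'n"
  assumes "transpose R = R" "R ** R = A" "invertible R"
  shows "matrix_inv A = matrix_inv R ** matrix_inv R" "transpose (matrix_inv R) = matrix_inv R"
proof -
  have "A ** (matrix_inv R ** matrix_inv R) = R ** (R ** matrix_inv R) ** matrix_inv R"
    by (simp only: assms(2)[symmetric] matrix_mul_assoc)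
  also have "\<dots> = mat 1" by (simp add: matrix_inv[OF assms(3)])
  finally show "matrix_inv A = matrix_inv R ** matrix_inv R" by (rule matrix_inv_unique)
  have "transpose (matrix_inv R ** R) = mat 1" by (simp add: matrix_inv[OF assms(3)])
  then have "R ** transpose (matrix_inv R) = mat 1" by (simp add: matrix_transpose_mul assms)
  then show "transpose (matrix_inv R) = matrix_inv R" 
    by (rule matrix_inv_unique[symmetric])
qed

text \<open>Makes the \<open>Max\<close> in \<open>lambda_max\<close> meaningful: the spectrum is
  the range of a function on a finite type, hence finite and nonempty.\<close>

lemma eigenvalues_diagonalized:
  fixes Q :: "real^'n^'n"
  assumes Q: "orthogonal_matrix Q" and A: "A = Q ** diag_mat d ** transpose Q"
  shows "{l. is_eigenvalue A l} = range d"
proof (intro set_eqI iffI; clarsimp)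
  fix l assume "is_eigenvalue A l"
  then obtain v where v: "v \<noteq> 0" "A *v v = l *\<^sub>R v" by (auto simp: is_eigenvalue_def)
  define w where "w = transpose Q *v v"
  have vw: "v = Q *v w" by (simp only: w_def orthogonal_matrix_cancel[OF Q])
  have "transpose Q *v (A *v v) = diag_mat d *v w"
    unfolding A matrix_vector_mul_assoc[symmetric] w_def orthogonal_matrix_cancel[OF Q] ..
  then have "diag_mat d *v w = l *\<^sub>R w"
    unfolding v by (simp add: matrix_vector_mult_scaleR w_def del: transpose_matrix_vector)
  then have *: "d i * w $ i = l * w $ i" for i by (simp add: diag_mat_vec vec_eq_iff)
  have "w \<noteq> 0" using v(1) vw by auto
  then obtain i where "w $ i \<noteq> 0" by (auto simp: vec_eq_iff)
  with *[of i] show "l \<in> range d" by auto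
next
  fix i
  have "A *v (Q *v axis i 1) = Q *v (diag_mat d *v axis i 1)"
    unfolding A matrix_vector_mul_assoc[symmetric] orthogonal_matrix_cancel[OF Q] ..
  also have "diag_mat d *v axis i 1 = d i *\<^sub>R axis i 1"
    by (simp add: diag_mat_vec vec_eq_iff axis_def)
  finally have "A *v (Q *v axis i 1) = d i *\<^sub>R (Q *v axis i 1)"
    by (simp add: matrix_vector_mult_scaleR)
  moreover have "Q *v axis i 1 \<noteq> 0"
  proof
    assume "Q *v axis i 1 = 0"
    then have "axis i (1::real) = 0" using orthogonal_matrix_cancel(1)[OF Q, of "axis i 1"] by simp
    then show False by (simp add: axis_eq_0_iff)
  qed
  ultimately show "is_eigenvalue A (d i)" unfolding is_eigenvalue_def by blast
qed

lemma quadratic_form_le_lambda_max: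
  fixes A :: "real^'n^'n"
  assumes "transpose A = A"
  shows "x \<bullet> (A *v x) \<le> lambda_max A * (x \<bullet> x)"
proof -
  obtain Q d where Q: "orthogonal_matrix Q" and A: "A = Q ** diag_mat d ** transpose Q"
    using symmetric_diagonalizable[OF assms] .
  have le: "d i \<le> lambda_max A" for i
    unfolding lambda_max_def eigenvalues_diagonalized[OF Q A] by (intro Max_ge) auto
  have "x \<bullet> (A *v x) = (\<Sum>i\<in>UNIV. d i * ((transpose Q *v x) $ i)\<^sup>2)"
    unfolding A by (rule quadratic_form_diagonalized)
  also have "\<dots> \<le> (\<Sum>i\<in>UNIV. lambda_max A * ((transpose Q *v x) $ i)\<^sup>2)"
    by (intro sum_mono mult_right_mono le) auto
  also have "\<dots> = lambda_max A * ((transpose Q *v x) \<bullet> (transpose Q *v x))"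
    by (simp add: sum_distrib_left inner_vec_def power2_eq_square)
  also have "\<dots> = lambda_max A * (x \<bullet> x)"
    using orthogonal_matrix_inner[of "transpose Q" x x] Q by simp
  finally show ?thesis .
qed

lemma pos_def_lambda_max_pos:
  fixes A :: "real^'n^'n"
  assumes "pos_def_mat A"
  shows "lambda_max A > 0"
proof -
  define x :: "real^'n" where "x = axis undefined 1"
  have x: "x \<noteq> 0" by (simp add: x_def axis_eq_0_iff)
  have "0 < x \<bullet> (A *v x)" using assms x by (simp add: pos_def_mat_def)
  also have "\<dots> \<le> lambda_max A * (x \<bullet> x)"
    using assms by (intro quadratic_form_le_lambda_max) (simp add: pos_def_mat_def)
  finally have "0 < lambda_max A * (x \<bullet> x)" .
  moreover have "0 < x \<bullet> x" using x by simp
  ultimately show ?thesis by (rule zero_less_mult_pos2)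
qed

text \<open>Ordinary Cauchy-Schwarz for the vectors \<open>matrix_inv R *v u\<close> and
  \<open>R *v x\<close>, with \<open>R\<close> the symmetric root of \<open>A\<close>.\<close>

lemma pos_def_cauchy_schwarz:
  fixes A :: "real^'n^'n"
  assumes "pos_def_mat A"
  shows "(u \<bullet> x)\<^sup>2 \<le> (u \<bullet> (matrix_inv A *v u)) * (x \<bullet> (A *v x))"
proof -
  obtain R where R: "transpose R = R" "R ** R = A" "invertible R"
    using pos_def_mat_sqrt[OF assms] .
  note inv = matrix_inv_sqrt[OF R]
  have "u \<bullet> x = u \<bullet> (matrix_inv R *v (R *v x))"
    by (simp add: matrix_vector_mul_assoc matrix_inv[OF R(3)])
  also have "\<dots> = (matrix_inv R *v u) \<bullet> (R *v x)"
    by (rule inner_symmetric_matrix[OF inv(2)])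
  finally have "(u \<bullet> x)\<^sup>2 \<le> ((matrix_inv R *v u) \<bullet> (matrix_inv R *v u)) * ((R *v x) \<bullet> (R *v x))"
    by (simp add: Cauchy_Schwarz_ineq)
  also have "(R *v x) \<bullet> (R *v x) = x \<bullet> (A *v x)"
    unfolding R(2)[symmetric] matrix_vector_mul_assoc[symmetric] by (rule inner_symmetric_matrix[OF R(1), symmetric])
  also have "(matrix_inv R *v u) \<bullet> (matrix_inv R *v u) = u \<bullet> (matrix_inv A *v u)"
    unfolding inv(1) matrix_vector_mul_assoc[symmetric] by (rule inner_symmetric_matrix[OF inv(2), symmetric])
  finally show ?thesis .
qed

lemma pos_def_matrix_inv_pos:
  fixes A :: "real^'n^'n"
  assumes "pos_def_mat A" "u \<noteq> 0"
  shows "u \<bullet> (matrix_inv A *v u) > 0"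
proof -
  have "0 < (u \<bullet> u)\<^sup>2" using assms(2) by simp
  also have "\<dots> \<le> (u \<bullet> (matrix_inv A *v u)) * (u \<bullet> (A *v u))"
    by (rule pos_def_cauchy_schwarz[OF assms(1)])
  finally have "0 < (u \<bullet> (matrix_inv A *v u)) * (u \<bullet> (A *v u))" .
  moreover have "0 < u \<bullet> (A *v u)" using assms by (simp add: pos_def_mat_def)
  ultimately show ?thesis by (simp add: zero_less_mult_iff)
qed

section \<open>Rank-one perturbations of a positive definite matrix\<close>

definition outer :: "real^'n \<Rightarrow> real^'n^'n" where
  "outer u = (\<chi> i j. u $ i * u $ j)"

lemma outer_vec: "outer u *v x = (u \<bullet> x) *\<^sub>R u"
  by (simp add: outer_def matrix_vector_mult_def vec_eq_iff inner_vec_def sum_distrib_left mult_ac)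

lemma outer_conj: "B ** outer u ** transpose B = outer (B *v u)"
  unfolding matrix_eq
proof
  fix x
  show "(B ** outer u ** transpose B) *v x = outer (B *v u) *v x"
    unfolding matrix_vector_mul_assoc[symmetric] outer_vec
    by (simp only: matrix_vector_mult_scaleR inner_matrix_adjoint transpose_transpose)
qed

text \<open>A rotation taking a coordinate axis to the direction of \<open>w\<close> makes the
  matrix diagonal with a single entry different from 1.\<close>

lemma det_one_minus_outer:
  fixes w :: "real^'n"
  shows "det (mat 1 - c *\<^sub>R outer w) = 1 - c * (w \<bullet> w)"
proof (cases "w = 0")
  case True
  then have "outer w = 0" by (simp add: outer_def vec_eq_iff)
  then show ?thesis using True by (simp add: det_I)
next
  case False
  define k :: 'n where "k = undefined"
  define a where "a = w /\<^sub>R norm w"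
  have "norm a = 1" using False by (simp add: a_def)
  then obtain Q where Q: "orthogonal_matrix Q" "Q *v axis k 1 = a"
    using orthogonal_matrix_exists_basis by metis
  have w: "w = Q *v (norm w *\<^sub>R axis k 1)"
    using Q(2) False by (simp add: matrix_vector_mult_scaleR a_def)
  define B :: "real^'n^'n" where "B = diag_mat (\<lambda>i. if i = k then 1 - c * (norm w)\<^sup>2 else 1)"
  have "mat 1 - c *\<^sub>R outer w = Q ** B ** transpose Q"
  proof -
    have "B = mat 1 - c *\<^sub>R outer (norm w *\<^sub>R axis k 1)"
      by (auto simp: B_def vec_eq_iff mat_def outer_def axis_def power2_eq_square)
    moreover have "Q ** (mat 1 - c *\<^sub>R M) ** transpose Q = mat 1 - c *\<^sub>R (Q ** M ** transpose Q)" for M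
    proof -
      have "(Q ** (mat 1 - c *\<^sub>R M) ** transpose Q) *v x = (mat 1 - c *\<^sub>R (Q ** M ** transpose Q)) *v x" for x
        unfolding matrix_vector_mul_assoc[symmetric]
        by (simp only: matrix_vector_mult_diff_rdistrib matrix_vector_mult_diff_distrib matrix_vector_mul_lid
            orthogonal_matrix_cancel[OF Q(1)] scaleR_matrix_vector_assoc[symmetric] matrix_vector_mult_scaleR
            matrix_vector_mul_assoc[symmetric])
      then show ?thesis by (metis matrix_eq)
    qed
    ultimately show ?thesis by (simp only: outer_conj w[symmetric])
  qed
  then have "det (mat 1 - c *\<^sub>R outer w) = det B" by (simp only: det_orthogonal_conj[OF Q(1)])
  also have "\<dots> = 1 - c * (w \<bullet> w)" by (simp add: B_def prod.delta dot_square_norm)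
  finally show ?thesis .
qed

text \<open>The matrix determinant lemma, reduced to a perturbation of the identity by congruence
  with the root of \<open>A\<close>.\<close>

lemma det_pos_def_minus_outer:
  fixes A :: "real^'n^'n"
  assumes "pos_def_mat A"
  shows "det (A - c *\<^sub>R outer u) = det A * (1 - c * (u \<bullet> (matrix_inv A *v u)))"
proof -
  obtain R where R: "transpose R = R" "R ** R = A" "invertible R"
    using pos_def_mat_sqrt[OF assms] .
  note inv = matrix_inv_sqrt[OF R]
  define w where "w = matrix_inv R *v u"
  have Rw: "R *v w = u" by (simp add: w_def matrix_vector_mul_assoc matrix_inv[OF R(3)])
  have "(R ** (mat 1 - c *\<^sub>R outer w) ** transpose R) *v x = (A - c *\<^sub>R outer u) *v x" for x
    unfolding Rw[symmetric] outer_conj[symmetric] R(2)[symmetric] matrix_vector_mul_assoc[symmetric]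
    by (simp only: matrix_vector_mult_diff_rdistrib matrix_vector_mult_diff_distrib matrix_vector_mul_lid
            scaleR_matrix_vector_assoc[symmetric] matrix_vector_mult_scaleR
            matrix_vector_mul_assoc[symmetric] R(1))
  then have "A - c *\<^sub>R outer u = R ** (mat 1 - c *\<^sub>R outer w) ** transpose R" by (metis matrix_eq)
  then have "det (A - c *\<^sub>R outer u) = det A * (1 - c * (w \<bullet> w))"
    by (simp add: det_mul det_one_minus_outer R(2)[symmetric])
  also have "w \<bullet> w = u \<bullet> (matrix_inv A *v u)"
    unfolding inv(1) w_def matrix_vector_mul_assoc[symmetric] by (rule inner_symmetric_matrix[OF inv(2), symmetric])
  finally show ?thesis .
qed

text \<open>For positive \<open>c\<close> the weighted Cauchy-Schwarz inequality bounds the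
  subtracted form by a fraction below 1 of the form of \<open>A\<close>; for other \<open>c\<close>
  nothing is lost.\<close>

lemma pos_def_minus_outer:
  fixes A :: "real^'n^'n"
  assumes A: "pos_def_mat A" and c: "c * (u \<bullet> (matrix_inv A *v u)) < 1"
  shows "pos_def_mat (A - c *\<^sub>R outer u)"
  unfolding pos_def_mat_def
proof (intro conjI allI impI)
  show "transpose (A - c *\<^sub>R outer u) = A - c *\<^sub>R outer u"
    using A by (simp add: pos_def_mat_def outer_def transpose_def vec_eq_iff mult.commute)
  fix x :: "real^'n" assume "x \<noteq> 0"
  then have pos: "x \<bullet> (A *v x) > 0" using A by (simp add: pos_def_mat_def)
  have "x \<bullet> ((A - c *\<^sub>R outer u) *v x) = x \<bullet> (A *v x) - c * (u \<bullet> x)\<^sup>2"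
    by (simp add: matrix_vector_mult_diff_rdistrib scaleR_matrix_vector_assoc[symmetric] outer_vec
        inner_diff_right power2_eq_square inner_commute[of x u])
  moreover have "c * (u \<bullet> x)\<^sup>2 < x \<bullet> (A *v x)"
  proof (cases "c \<le> 0")
    case True
    then show ?thesis using pos by (meson le_less_trans mult_nonpos_nonneg zero_le_power2)
  next
    case False
    then have "c * (u \<bullet> x)\<^sup>2 \<le> c * ((u \<bullet> (matrix_inv A *v u)) * (x \<bullet> (A *v x)))"
      using pos_def_cauchy_schwarz[OF A, of u x] by (intro mult_left_mono) auto
    also have "\<dots> < 1 * (x \<bullet> (A *v x))"
      unfolding mult.assoc[symmetric] by (intro mult_strict_right_mono c pos)
    finally show ?thesis by simp
  qed
  ultimately show "x \<bullet> ((A - c *\<^sub>R outer u) *v x) > 0" by simp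
qed

section \<open>Gaussian integrals and concentration of quadratic forms\<close>

lemma borel_measurable_matrix_vector_mult [measurable]:
  fixes A :: "real^'n^'m"
  shows "(\<lambda>x. A *v x) \<in> borel_measurable borel"
  by (intro borel_measurable_continuous_onI linear_continuous_on linear_conv_bounded_linear[THEN iffD1] matrix_vector_mul_linear)

lemma nn_integral_gaussian_1d:
  assumes "d > 0"
  shows "(\<integral>\<^sup>+t. ennreal (exp (- (d * t\<^sup>2) / 2)) \<partial>lborel) = ennreal (sqrt (2 * pi / d))"
proof -
  have eq: "exp (- (d * t\<^sup>2) / 2) = sqrt (2 * pi / d) * normal_density 0 (1 / sqrt d) t" for t
    using assms by (simp add: normal_density_def power_divide real_sqrt_divide real_sqrt_mult mult.commute)
  have "(\<integral>\<^sup>+t. ennreal (exp (- (d * t\<^sup>2) / 2)) \<partial>lborel)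
      = ennreal (sqrt (2 * pi / d)) * (\<integral>\<^sup>+t. ennreal (normal_density 0 (1 / sqrt d) t) \<partial>lborel)"
    using assms unfolding eq by (subst nn_integral_cmult[symmetric]) (auto simp: ennreal_mult)
  also have "(\<integral>\<^sup>+t. ennreal (normal_density 0 (1 / sqrt d) t) \<partial>lborel) = 1"
    using assms by (subst nn_integral_eq_integral) auto
  finally show ?thesis by simp
qed

text \<open>Tonelli for a product of coordinate functions: the product over \<open>Basis\<close> is
  reindexed by the axis vectors to a product over the coordinate type.\<close>

lemma nn_integral_lborel_vec_prod:
  fixes f :: "'n::finite \<Rightarrow> real \<Rightarrow> ennreal"
  assumes [measurable]: "\<And>i. f i \<in> borel_measurable borel"
  shows "(\<integral>\<^sup>+x. (\<Prod>i\<in>UNIV. f i (x $ i)) \<partial>(lborel :: (real^'n) measure)) = (\<Prod>i\<in>UNIV. (\<integral>\<^sup>+t. f i t \<partial>lborel))"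
proof -
  let ?a = "\<lambda>i::'n. axis i (1::real)"
  have inj: "inj ?a" by (auto simp: inj_on_def axis_eq_axis)
  have B: "(Basis :: (real^'n) set) = range ?a" by (auto simp: Basis_vec_def)
  have P: "(\<Prod>b\<in>Basis. g (inv ?a b) b) = (\<Prod>i\<in>UNIV. g i (?a i))" for g :: "'n \<Rightarrow> real^'n \<Rightarrow> ennreal"
    unfolding B by (subst prod.reindex[OF inj]) (simp add: inv_f_f[OF inj])
  have "(\<integral>\<^sup>+x. (\<Prod>b\<in>Basis. f (inv ?a b) (x \<bullet> b)) \<partial>(lborel :: (real^'n) measure))
      = (\<Prod>b\<in>(Basis :: (real^'n) set). (\<integral>\<^sup>+t. f (inv ?a b) t \<partial>lborel))"
    by (rule nn_integral_lborel_prod) auto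
  moreover have "(\<Prod>b\<in>Basis. f (inv ?a b) (x \<bullet> b)) = (\<Prod>i\<in>UNIV. f i (x $ i))" for x :: "real^'n"
    using P[of "\<lambda>i b. f i (x \<bullet> b)"] by (simp add: cart_eq_inner_axis)
  moreover have "(\<Prod>b\<in>(Basis :: (real^'n) set). (\<integral>\<^sup>+t. f (inv ?a b) t \<partial>lborel)) = (\<Prod>i\<in>UNIV. (\<integral>\<^sup>+t. f i t \<partial>lborel))"
    using P[of "\<lambda>i b. (\<integral>\<^sup>+t. f i t \<partial>lborel)"] by simp
  ultimately show ?thesis by simp
qed

lemma sqrt_prod: "sqrt (\<Prod>i\<in>I. f i) = (\<Prod>i\<in>I. sqrt (f i))"
  by (induction I rule: infinite_finite_induct) (auto simp: real_sqrt_mult)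

lemma nn_integral_gaussian_diag:
  fixes d :: "'n::finite \<Rightarrow> real"
  assumes d: "\<And>i. d i > 0"
  shows "(\<integral>\<^sup>+x. ennreal (exp (- (\<Sum>i\<in>UNIV. d i * (x $ i)\<^sup>2) / 2)) \<partial>(lborel :: (real^'n) measure))
    = ennreal ((2 * pi) powr (real CARD('n) / 2) / sqrt (\<Prod>i\<in>UNIV. d i))"
proof -
  have "exp (- (\<Sum>i\<in>UNIV. d i * (x $ i)\<^sup>2) / 2) = (\<Prod>i\<in>UNIV. exp (- (d i * (x $ i)\<^sup>2) / 2))" for x :: "real^'n"
    by (simp add: exp_sum[symmetric] sum_divide_distrib sum_negf)
  then have "(\<integral>\<^sup>+x. ennreal (exp (- (\<Sum>i\<in>UNIV. d i * (x $ i)\<^sup>2) / 2)) \<partial>(lborel :: (real^'n) measure))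
      = (\<integral>\<^sup>+x. (\<Prod>i\<in>UNIV. ennreal (exp (- (d i * (x $ i)\<^sup>2) / 2))) \<partial>(lborel :: (real^'n) measure))"
    by (simp add: prod_ennreal)
  also have "\<dots> = (\<Prod>i\<in>UNIV. ennreal (sqrt (2 * pi / d i)))"
    unfolding nn_integral_gaussian_1d[OF d, symmetric] by (rule nn_integral_lborel_vec_prod) measurable
  also have "\<dots> = ennreal (\<Prod>i\<in>UNIV. sqrt (2 * pi / d i))"
    using d by (subst prod_ennreal) (auto simp: less_imp_le)
  also have "(\<Prod>i\<in>UNIV. sqrt (2 * pi / d i)) = (2 * pi) powr (real CARD('n) / 2) / sqrt (\<Prod>i\<in>UNIV. d i)"
    by (simp add: real_sqrt_divide prod_dividef sqrt_prod powr_half_sqrt[symmetric] powr_powr powr_realpow[symmetric])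
  finally show ?thesis .
qed

text \<open>Weighting with a rotation invariant Gaussian density, translation invariance and
  Tonelli move the rotation from the integrand to the weight.\<close>
lemma nn_integral_lborel_orthogonal:
  fixes Q :: "real^'n^'n"
  assumes Q: "orthogonal_matrix Q" and [measurable]: "g \<in> borel_measurable borel"
  shows "(\<integral>\<^sup>+x. g (Q *v x) \<partial>lborel) = (\<integral>\<^sup>+x. g x \<partial>lborel)"
proof -
  define f :: "real^'n \<Rightarrow> ennreal" where "f x = ennreal (exp (- (x \<bullet> x) / 2))" for x
  have fm [measurable]: "f \<in> borel_measurable borel" unfolding f_def by measurable
  have shift: "(\<integral>\<^sup>+x. h (x + c) \<partial>lborel) = (\<integral>\<^sup>+x. h x \<partial>lborel)"
    if [measurable]: "h \<in> borel_measurable borel" for h :: "real^'n \<Rightarrow> ennreal" and c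
  proof -
    have "(\<integral>\<^sup>+x. h x \<partial>lborel) = (\<integral>\<^sup>+x. h x \<partial>distr lborel borel ((+) c))"
      by (simp add: lborel_distr_plus)
    also have "\<dots> = (\<integral>\<^sup>+x. h (x + c) \<partial>lborel)"
      by (subst nn_integral_distr) (auto simp: add.commute)
    finally show ?thesis by simp
  qed
  have fI: "(\<integral>\<^sup>+x. f x \<partial>lborel) = ennreal ((2 * pi) powr (real CARD('n) / 2))"
    using nn_integral_gaussian_diag[of "\<lambda>i::'n. 1"]
    by (simp add: f_def inner_vec_def power2_eq_square)
  let ?T = "\<lambda>x. transpose Q *v x"
  have f_rot: "f (x - Q *v y) = f (y - ?T x)" for x y
  proof -
    have "y - ?T x = - (transpose Q *v (x - Q *v y))"
      by (simp only: matrix_vector_mult_diff_distrib orthogonal_matrix_cancel[OF Q] minus_diff_eq)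
    then have "(y - ?T x) \<bullet> (y - ?T x) = (x - Q *v y) \<bullet> (x - Q *v y)"
      using orthogonal_matrix_inner[of "transpose Q"] Q by simp
    then show ?thesis by (simp add: f_def)
  qed
  have "(\<integral>\<^sup>+x. f x \<partial>lborel) * (\<integral>\<^sup>+y. g (Q *v y) \<partial>lborel) = (\<integral>\<^sup>+x. (\<integral>\<^sup>+y. f x * g (Q *v y) \<partial>lborel) \<partial>lborel)"
    by (simp add: nn_integral_cmult nn_integral_multc)
  also have "\<dots> = (\<integral>\<^sup>+x. (\<integral>\<^sup>+y. f x * g (x + Q *v y) \<partial>lborel) \<partial>lborel)"
  proof (rule nn_integral_cong)
    fix x
    have "(\<integral>\<^sup>+y. f x * g (Q *v (y + ?T x)) \<partial>lborel) = (\<integral>\<^sup>+y. f x * g (Q *v y) \<partial>lborel)"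
      by (rule shift) measurable
    moreover have "Q *v (y + ?T x) = x + Q *v y" for y
      by (simp only: matrix_vector_right_distrib orthogonal_matrix_cancel[OF Q] add.commute)
    ultimately show "(\<integral>\<^sup>+y. f x * g (Q *v y) \<partial>lborel) = (\<integral>\<^sup>+y. f x * g (x + Q *v y) \<partial>lborel)"
      by simp
  qed
  also have "\<dots> = (\<integral>\<^sup>+y. (\<integral>\<^sup>+x. f x * g (x + Q *v y) \<partial>lborel) \<partial>lborel)"
    by (rule lborel_pair.Fubini') measurable
  also have "\<dots> = (\<integral>\<^sup>+y. (\<integral>\<^sup>+x. f (x - Q *v y) * g x \<partial>lborel) \<partial>lborel)"
  proof (rule nn_integral_cong)
    fix y
    have "(\<integral>\<^sup>+x. f (x + Q *v y - Q *v y) * g (x + Q *v y) \<partial>lborel) = (\<integral>\<^sup>+x. f (x - Q *v y) * g x \<partial>lborel)"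
      by (rule shift) measurable
    then show "(\<integral>\<^sup>+x. f x * g (x + Q *v y) \<partial>lborel) = (\<integral>\<^sup>+x. f (x - Q *v y) * g x \<partial>lborel)"
      by simp
  qed
  also have "\<dots> = (\<integral>\<^sup>+x. (\<integral>\<^sup>+y. f (x - Q *v y) * g x \<partial>lborel) \<partial>lborel)"
    by (rule lborel_pair.Fubini'[symmetric]) measurable
  also have "\<dots> = (\<integral>\<^sup>+x. (\<integral>\<^sup>+y. f y \<partial>lborel) * g x \<partial>lborel)"
  proof (rule nn_integral_cong)
    fix x
    have "(\<integral>\<^sup>+y. f (y + - ?T x) \<partial>lborel) = (\<integral>\<^sup>+y. f y \<partial>lborel)"
      by (rule shift) measurable
    then show "(\<integral>\<^sup>+y. f (x - Q *v y) * g x \<partial>lborel) = (\<integral>\<^sup>+y. f y \<partial>lborel) * g x"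
      unfolding f_rot by (subst nn_integral_multc) (auto simp del: transpose_matrix_vector)
  qed
  also have "\<dots> = (\<integral>\<^sup>+y. f y \<partial>lborel) * (\<integral>\<^sup>+x. g x \<partial>lborel)"
    by (rule nn_integral_cmult) measurable
  \<comment> \<open>The total weight is positive and finite, so it cancels in the extended
    nonnegative reals.\<close>
  finally show ?thesis unfolding fI by (simp add: ennreal_mult_cancel_left)
qed

text \<open>Diagonalization and rotation invariance of Lebesgue measure split the integral into
  one-dimensional Gaussian integrals, and the product of the eigenvalues is the determinant.\<close>

theorem nn_integral_gaussian:
  fixes A :: "real^'n^'n"
  assumes "pos_def_mat A"
  shows "(\<integral>\<^sup>+x. ennreal (exp (- (x \<bullet> (A *v x)) / 2)) \<partial>lborel)
    = ennreal ((2 * pi) powr (real CARD('n) / 2) / sqrt (det A))"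
proof -
  obtain Q d where Q: "orthogonal_matrix Q" and A: "A = Q ** diag_mat d ** transpose Q"
    and d: "\<And>i. d i > 0" using pos_def_mat_diagonalizable[OF assms] by blast
  have "(\<integral>\<^sup>+x. ennreal (exp (- (x \<bullet> (A *v x)) / 2)) \<partial>lborel)
      = (\<integral>\<^sup>+x. ennreal (exp (- (\<Sum>i\<in>UNIV. d i * ((transpose Q *v x) $ i)\<^sup>2) / 2)) \<partial>lborel)"
    unfolding A quadratic_form_diagonalized ..
  also have "\<dots> = (\<integral>\<^sup>+x. ennreal (exp (- (\<Sum>i\<in>UNIV. d i * (x $ i)\<^sup>2) / 2)) \<partial>(lborel :: (real^'n) measure))"
    by (rule nn_integral_lborel_orthogonal[of "transpose Q"
          "\<lambda>x. ennreal (exp (- (\<Sum>i\<in>UNIV. d i * (x $ i)\<^sup>2) / 2))"]) (use Q in auto)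
  also have "\<dots> = ennreal ((2 * pi) powr (real CARD('n) / 2) / sqrt (\<Prod>i\<in>UNIV. d i))"
    by (rule nn_integral_gaussian_diag[OF d])
  also have "(\<Prod>i\<in>UNIV. d i) = det A"
    unfolding A det_orthogonal_conj[OF Q] by simp
  finally show ?thesis .
qed

section \<open>The Gaussian law, its exponential moments and tail bounds\<close>

lemma space_mvnormal_prec [simp]: "space (mvnormal_prec A) = UNIV"
  by (simp add: mvnormal_prec_def)

lemma sets_mvnormal_prec [measurable_cong, simp]: "sets (mvnormal_prec A) = sets borel"
  by (simp add: mvnormal_prec_def)

text \<open>The factor \<open>exp (s * (u \<bullet> x)\<^sup>2)\<close> only changes the precision
  matrix to \<open>A - (2 * s) *\<^sub>R outer u\<close>, so the moment is a ratio of two Gaussian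
  normalizing constants. Negative \<open>s\<close> is allowed and will serve the lower tail.\<close>

lemma mvnormal_prec_mgf_square:
  fixes A :: "real^'n^'n"
  assumes A: "pos_def_mat A" and s: "2 * s * (u \<bullet> (matrix_inv A *v u)) < 1"
  shows "(\<integral>\<^sup>+x. ennreal (exp (s * (u \<bullet> x)\<^sup>2)) \<partial>mvnormal_prec A)
    = ennreal (1 / sqrt (1 - 2 * s * (u \<bullet> (matrix_inv A *v u))))"
proof -
  define B where "B = A - (2 * s) *\<^sub>R outer u"
  have B: "pos_def_mat B" unfolding B_def using s by (intro pos_def_minus_outer A) (simp add: mult.assoc)
  define c where "c = (2 * pi) powr (- real CARD('n) / 2) * sqrt (det A)"
  have c: "c \<ge> 0" using det_pos_def[OF A] by (simp add: c_def)
  have q: "x \<bullet> (B *v x) = x \<bullet> (A *v x) - 2 * s * (u \<bullet> x)\<^sup>2" for x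
    by (simp add: B_def matrix_vector_mult_diff_rdistrib scaleR_matrix_vector_assoc[symmetric] outer_vec
        inner_diff_right power2_eq_square inner_commute[of x u])
  have "(\<integral>\<^sup>+x. ennreal (exp (s * (u \<bullet> x)\<^sup>2)) \<partial>mvnormal_prec A)
      = (\<integral>\<^sup>+x. ennreal (c * exp (- (x \<bullet> (A *v x)) / 2)) * ennreal (exp (s * (u \<bullet> x)\<^sup>2)) \<partial>lborel)"
    unfolding mvnormal_prec_def c_def by (subst nn_integral_density) auto
  also have "\<dots> = (\<integral>\<^sup>+x. ennreal c * ennreal (exp (- (x \<bullet> (B *v x)) / 2)) \<partial>lborel)"
  proof (rule nn_integral_cong)
    fix x
    have "exp (- (x \<bullet> (B *v x)) / 2) = exp (- (x \<bullet> (A *v x)) / 2) * exp (s * (u \<bullet> x)\<^sup>2)"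
      unfolding q by (simp add: exp_add[symmetric] diff_divide_distrib)
    then show "ennreal (c * exp (- (x \<bullet> (A *v x)) / 2)) * ennreal (exp (s * (u \<bullet> x)\<^sup>2))
        = ennreal c * ennreal (exp (- (x \<bullet> (B *v x)) / 2))"
      using c by (simp add: ennreal_mult[symmetric] mult.assoc)
  qed
  also have "\<dots> = ennreal (c * ((2 * pi) powr (real CARD('n) / 2) / sqrt (det B)))"
  proof -
    have "(\<integral>\<^sup>+x. ennreal c * ennreal (exp (- (x \<bullet> (B *v x)) / 2)) \<partial>lborel)
        = ennreal c * (\<integral>\<^sup>+x. ennreal (exp (- (x \<bullet> (B *v x)) / 2)) \<partial>lborel)"
      by (rule nn_integral_cmult) measurable
    then show ?thesis unfolding nn_integral_gaussian[OF B]
      using c det_pos_def[OF B] by (simp add: ennreal_mult[symmetric] del: times_divide_eq_right)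
  qed
  also have "c * ((2 * pi) powr (real CARD('n) / 2) / sqrt (det B)) = sqrt (det A) / sqrt (det B)"
    unfolding c_def by (simp add: powr_minus powr_minus_divide)
  also have "\<dots> = 1 / sqrt (1 - 2 * s * (u \<bullet> (matrix_inv A *v u)))"
    using det_pos_def[OF A] unfolding B_def det_pos_def_minus_outer[OF A] by (simp add: real_sqrt_mult)
  finally show ?thesis .
qed

lemma prob_space_mvnormal_prec:
  fixes A :: "real^'n^'n"
  assumes "pos_def_mat A"
  shows "prob_space (mvnormal_prec A)"
proof
  \<comment> \<open>The total mass is the trivial exponential moment, with \<open>s = 0\<close> and
    \<open>u = 0\<close>.\<close>
  have "(\<integral>\<^sup>+x. 1 \<partial>mvnormal_prec A) = 1"
    using mvnormal_prec_mgf_square[OF assms, of 0 0] by simp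
  then show "emeasure (mvnormal_prec A) (space (mvnormal_prec A)) = 1" by simp
qed

lemma prob_space_sample_law:
  "pos_def_mat A \<Longrightarrow> prob_space (sample_law n A)"
  unfolding sample_law_def by (intro prob_space_PiM prob_space_mvnormal_prec)

text \<open>Markov's inequality for the exponential, whose expectation factors over the independent
  observations. The sign of \<open>s\<close> selects the tail: positive for large sums, negative for
  small ones.\<close>

lemma sample_law_chernoff:
  fixes A :: "real^'n^'n"
  assumes A: "pos_def_mat A" and s: "2 * s * (u \<bullet> (matrix_inv A *v u)) < 1"
  shows "measure (sample_law n A) {X \<in> space (sample_law n A). a \<le> s * (\<Sum>i<n. (u \<bullet> X i)\<^sup>2)}
    \<le> exp (- a) * (1 / sqrt (1 - 2 * s * (u \<bullet> (matrix_inv A *v u)))) ^ n"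
proof -
  interpret M: prob_space "mvnormal_prec A" by (rule prob_space_mvnormal_prec[OF A])
  interpret P: product_sigma_finite "\<lambda>i::nat. mvnormal_prec A" ..
  let ?P = "sample_law n A"
  interpret SP: prob_space ?P by (rule prob_space_sample_law[OF A])
  let ?m = "1 / sqrt (1 - 2 * s * (u \<bullet> (matrix_inv A *v u)))"
  have meas [measurable]: "(\<lambda>X. s * (\<Sum>i<n. (u \<bullet> X i)\<^sup>2)) \<in> borel_measurable ?P"
    unfolding sample_law_def by measurable
  have "emeasure ?P {X \<in> space ?P. a \<le> s * (\<Sum>i<n. (u \<bullet> X i)\<^sup>2)}
      = emeasure ?P {X \<in> space ?P. 1 \<le> ennreal (exp (- a)) * ennreal (exp (s * (\<Sum>i<n. (u \<bullet> X i)\<^sup>2)))}"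
    by (intro arg_cong2[where f=emeasure] Collect_cong refl conj_cong)
      (simp add: ennreal_mult[symmetric] exp_add[symmetric] ennreal_1[symmetric] del: ennreal_1)
  also have "\<dots> \<le> ennreal (exp (- a)) * (\<integral>\<^sup>+X. ennreal (exp (s * (\<Sum>i<n. (u \<bullet> X i)\<^sup>2))) * indicator (space ?P) X \<partial>?P)"
    by (rule nn_integral_Markov_inequality) auto
  also have "(\<integral>\<^sup>+X. ennreal (exp (s * (\<Sum>i<n. (u \<bullet> X i)\<^sup>2))) * indicator (space ?P) X \<partial>?P)
      = (\<integral>\<^sup>+X. (\<Prod>i<n. ennreal (exp (s * (u \<bullet> X i)\<^sup>2))) \<partial>?P)"
    by (intro nn_integral_cong) (simp add: prod_ennreal exp_sum[symmetric] sum_distrib_left)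
  also have "\<dots> = ennreal ?m ^ n"
    unfolding sample_law_def
    by (subst P.product_nn_integral_prod) (auto simp: mvnormal_prec_mgf_square[OF A s])
  also have "ennreal (exp (- a)) * ennreal ?m ^ n = ennreal (exp (- a) * ?m ^ n)"
    using s by (simp add: ennreal_mult ennreal_power)
  finally show ?thesis
    using s by (simp add: SP.emeasure_eq_measure)
qed

text \<open>The difference of the two sides vanishes at 1 and has derivative
  \<open>(1 - 1 / x)\<^sup>2 / 2\<close>. This sharpening of \<open>ln z \<le> z - 1\<close> is
  accurate to second order, as the tail bound and the divergence bound both require.\<close>

lemma ln_le_half_diff_inverse:
  assumes "(z::real) \<ge> 1"
  shows "ln z \<le> (z - 1 / z) / 2"
proof -
  define f where "f t = (t - 1 / t) / 2 - ln t" for t :: real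
  have "f 1 \<le> f z"
  proof (rule DERIV_nonneg_imp_nondecreasing[OF assms])
    fix x :: real assume x: "1 \<le> x" "x \<le> z"
    have "(f has_real_derivative ((1 + 1 / x\<^sup>2) / 2 - 1 / x)) (at x)"
      unfolding f_def using x by (auto intro!: derivative_eq_intros simp: field_simps power2_eq_square)
    moreover have "(1 + 1 / x\<^sup>2) / 2 - 1 / x = (1 - 1 / x)\<^sup>2 / 2"
      using x by (simp add: power2_eq_square field_simps)
    ultimately show "\<exists>y. (f has_real_derivative y) (at x) \<and> y \<ge> 0" by auto
  qed
  then show ?thesis by (simp add: f_def)
qed

text \<open>Controls the logarithm of the exponential moment for both signs of \<open>y\<close>,
  that is, for both tails. For \<open>y \<ge> 0\<close> it follows from the preceding bound at
  \<open>1 / (1 - y)\<close>.\<close>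

lemma ln_one_minus_ge:
  assumes "\<bar>y::real\<bar> \<le> 1 / 2"
  shows "- y - y\<^sup>2 \<le> ln (1 - y)"
proof (cases "y \<ge> 0")
  case True
  then have y: "0 \<le> y" "y \<le> 1 / 2" using assms by auto
  have "ln (1 / (1 - y)) \<le> (1 / (1 - y) - 1 / (1 / (1 - y))) / 2"
    using y by (intro ln_le_half_diff_inverse) (simp add: field_simps)
  also have "\<dots> = (2 * y - y\<^sup>2) / (2 * (1 - y))"
    using y by (simp add: field_simps power2_eq_square)
  also have "\<dots> \<le> y + y\<^sup>2"
  proof -
    have "y\<^sup>2 * (2 * y) \<le> y\<^sup>2 * 1" using y by (intro mult_left_mono) auto
    then have "2 * y - y\<^sup>2 \<le> (y + y\<^sup>2) * (2 * (1 - y))"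
      by (simp add: algebra_simps power2_eq_square)
    then show ?thesis using y by (simp add: pos_divide_le_eq)
  qed
  finally show ?thesis using y by (simp add: ln_div)
next
  case False
  then show ?thesis using assms ln_one_plus_pos_lower_bound[of "- y"] by auto
qed

text \<open>Two Chernoff bounds with \<open>s = t / (4 * v)\<close> and its negative, one for each
  tail.\<close>

lemma sample_law_square_sum_concentration:
  fixes A :: "real^'n^'n" and u :: "real^'n"
  assumes A: "pos_def_mat A" and t: "0 < t" "t \<le> 1"
  defines "v \<equiv> u \<bullet> (matrix_inv A *v u)"
  shows "measure (sample_law n A)
    {X \<in> space (sample_law n A). \<not> \<bar>(\<Sum>i<n. (u \<bullet> X i)\<^sup>2) - real n * v\<bar> \<le> real n * v * t}
    \<le> 2 * exp (- (real n * t\<^sup>2 / 8))"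
proof (cases "u = 0")
  \<comment> \<open>In the zero direction both the sum and \<open>v\<close> vanish, so the event is
    empty; this case is separated because \<open>s\<close> divides by \<open>v\<close>.\<close>
  case True
  then show ?thesis by (simp add: v_def)
next
  case False
  interpret SP: prob_space "sample_law n A" by (rule prob_space_sample_law[OF A])
  let ?S = "sample_law n A"
  have v: "v > 0" unfolding v_def by (rule pos_def_matrix_inv_pos[OF A False])
  \<comment> \<open>Since \<open>4 * s * v\<close> is \<open>t\<close> or \<open>- t\<close>, the
    threshold \<open>1 + 4 * s * v\<close> covers both tails at once. The exponent is
    \<open>- 4 * n * (s * v)\<^sup>2\<close> from the deviation plus
    \<open>2 * n * (s * v)\<^sup>2\<close> from the moment bound; with
    \<open>\<bar>s * v\<bar> = t / 4\<close> this leaves \<open>- n * t\<^sup>2 / 8\<close>.\<close>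
  have chern: "measure ?S {X \<in> space ?S. s * (real n * v * (1 + 4 * s * v)) \<le> s * (\<Sum>i<n. (u \<bullet> X i)\<^sup>2)}
      \<le> exp (- (real n * t\<^sup>2 / 8))" if s: "\<bar>s\<bar> = t / (4 * v)" for s
  proof -
    have sv: "\<bar>s * v\<bar> = t / 4" using s v by (simp add: abs_mult)
    then have y: "\<bar>2 * s * v\<bar> \<le> 1 / 2" using t by (simp add: mult.assoc abs_mult)
    then have lt: "2 * s * v < 1" by linarith
    have sq: "(s * v)\<^sup>2 = t\<^sup>2 / 16" using arg_cong[OF sv, of "\<lambda>x. x\<^sup>2"] by (simp add: power_divide)
    have "1 / sqrt (1 - 2 * s * v) = exp (- (ln (1 - 2 * s * v) / 2))"
      using lt by (simp add: exp_minus ln_sqrt[symmetric] inverse_eq_divide)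
    also have "\<dots> \<le> exp (s * v + 2 * (s * v)\<^sup>2)"
      using ln_one_minus_ge[OF y] by (simp add: power2_eq_square)
    finally have "(1 / sqrt (1 - 2 * s * v)) ^ n \<le> exp (s * v + 2 * (s * v)\<^sup>2) ^ n"
      using lt by (intro power_mono) auto
    also have "\<dots> = exp (real n * (s * v + 2 * (s * v)\<^sup>2))" by (simp add: exp_of_nat_mult)
    finally have "exp (- (s * (real n * v * (1 + 4 * s * v)))) * (1 / sqrt (1 - 2 * s * v)) ^ n
      \<le> exp (- (s * (real n * v * (1 + 4 * s * v)))) * exp (real n * (s * v + 2 * (s * v)\<^sup>2))"
      by (intro mult_left_mono) auto
    also have "\<dots> = exp (- (real n * (2 * (s * v)\<^sup>2)))"
      unfolding exp_add[symmetric] by (simp add: power2_eq_square algebra_simps)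
    also have "\<dots> = exp (- (real n * t\<^sup>2 / 8))" unfolding sq by simp
    finally show ?thesis
      using sample_law_chernoff[OF A, of s u n "s * (real n * v * (1 + 4 * s * v))"] lt
      by (simp add: v_def)
  qed
  have meas [measurable]: "(\<lambda>X. \<Sum>i<n. (u \<bullet> X i)\<^sup>2) \<in> borel_measurable ?S"
    unfolding sample_law_def by measurable
  let ?s = "t / (4 * v)"
  let ?U = "\<lambda>s. {X \<in> space ?S. s * (real n * v * (1 + 4 * s * v)) \<le> s * (\<Sum>i<n. (u \<bullet> X i)\<^sup>2)}"
  have Um: "?U s \<in> sets ?S" for s by measurable
  have sp: "?s > 0" using t v by simp
  have "measure ?S {X \<in> space ?S. \<not> \<bar>(\<Sum>i<n. (u \<bullet> X i)\<^sup>2) - real n * v\<bar> \<le> real n * v * t}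
      \<le> measure ?S (?U ?s \<union> ?U (- ?s))"
  proof (rule SP.finite_measure_mono)
    show "{X \<in> space ?S. \<not> \<bar>(\<Sum>i<n. (u \<bullet> X i)\<^sup>2) - real n * v\<bar> \<le> real n * v * t} \<subseteq> ?U ?s \<union> ?U (- ?s)"
    proof
      fix X assume "X \<in> {X \<in> space ?S. \<not> \<bar>(\<Sum>i<n. (u \<bullet> X i)\<^sup>2) - real n * v\<bar> \<le> real n * v * t}"
      then have X: "X \<in> space ?S" and or: "real n * v * (1 + t) \<le> (\<Sum>i<n. (u \<bullet> X i)\<^sup>2) \<or> (\<Sum>i<n. (u \<bullet> X i)\<^sup>2) \<le> real n * v * (1 - t)"
        by (auto simp: algebra_simps abs_real_def split: if_splits)
      have e: "1 + 4 * ?s * v = 1 + t" "1 + 4 * (- ?s) * v = 1 - t" using v by simp_all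
      from or show "X \<in> ?U ?s \<union> ?U (- ?s)"
      proof
        assume "real n * v * (1 + t) \<le> (\<Sum>i<n. (u \<bullet> X i)\<^sup>2)"
        then have "?s * (real n * v * (1 + t)) \<le> ?s * (\<Sum>i<n. (u \<bullet> X i)\<^sup>2)"
          using sp by (intro mult_left_mono) auto
        then have "X \<in> ?U ?s" using X unfolding mem_Collect_eq e by simp
        then show ?thesis ..
      next
        assume "(\<Sum>i<n. (u \<bullet> X i)\<^sup>2) \<le> real n * v * (1 - t)"
        then have "?s * (\<Sum>i<n. (u \<bullet> X i)\<^sup>2) \<le> ?s * (real n * v * (1 - t))"
          using sp by (intro mult_left_mono) auto
        then have "X \<in> ?U (- ?s)" using X unfolding mem_Collect_eq e by simp
        then show ?thesis ..
      qed
    qed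
  qed (use Um in auto)
  also have "\<dots> \<le> measure ?S (?U ?s) + measure ?S (?U (- ?s))"
    by (rule measure_Un_le) (use Um in auto)
  also have "\<dots> \<le> exp (- (real n * t\<^sup>2 / 8)) + exp (- (real n * t\<^sup>2 / 8))"
    by (intro add_mono chern) (use t v in auto)
  finally show ?thesis by simp
qed

section \<open>The likelihood gap on the event of small covariance error\<close>

lemma inner_mat_eq_sum: "(A :: real^'m^'n) \<bullet> B = (\<Sum>j\<in>UNIV. \<Sum>k\<in>UNIV. A $ j $ k * B $ j $ k)"
  by (simp add: inner_vec_def)

lemma matrix_add_rdistrib: "(A + B) ** C = A ** C + B ** (C :: real^'p^'n)"
  by (simp add: matrix_matrix_mult_def vec_eq_iff sum.distrib distrib_right)

lemma matrix_diff_ldistrib: "A ** (B - C) = A ** B - A ** (C :: real^'p^'n)"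
  by (simp add: matrix_matrix_mult_def vec_eq_iff sum_subtractf right_diff_distrib)

lemma norm_transpose: "norm (transpose (A :: real^'m^'n)) = norm A"
proof -
  have "transpose A \<bullet> transpose A = A \<bullet> A"
    unfolding inner_mat_eq_sum by (subst sum.swap) (simp add: transpose_def)
  then show ?thesis by (simp add: norm_eq_sqrt_inner)
qed

lemma norm_mat_eq_columns: "(norm (A :: real^'m^'n))\<^sup>2 = (\<Sum>k\<in>UNIV. column k A \<bullet> column k A)"
  unfolding power2_norm_eq_inner inner_mat_eq_sum
  by (subst sum.swap) (simp add: column_def inner_vec_def)

lemma norm_mat_one: "(norm (mat 1 :: real^'n^'n))\<^sup>2 = real CARD('n)"
  unfolding norm_mat_eq_columns
  by (simp add: column_def inner_vec_def mat_def if_distrib mult_delta_left cong: if_cong)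

text \<open>Column by column, the squared length of \<open>R *v y\<close> is the quadratic form of
  \<open>A\<close> at \<open>y\<close>.\<close>

lemma norm_sqrt_mult_le:
  fixes A R Y :: "real^'n^'n"
  assumes R: "transpose R = R" "R ** R = A"
  shows "(norm (R ** Y))\<^sup>2 \<le> lambda_max A * (norm Y)\<^sup>2"
proof -
  have symA: "transpose A = A" using R by (auto simp: matrix_transpose_mul)
  have "column k (R ** Y) \<bullet> column k (R ** Y) \<le> lambda_max A * (column k Y \<bullet> column k Y)" for k
  proof -
    have c: "column k (R ** Y) = R *v column k Y"
      by (simp add: column_def matrix_matrix_mult_def matrix_vector_mult_def vec_eq_iff)
    have "(R *v column k Y) \<bullet> (R *v column k Y) = column k Y \<bullet> (A *v column k Y)"
      unfolding R(2)[symmetric] matrix_vector_mul_assoc[symmetric]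
      by (rule inner_symmetric_matrix[OF R(1), symmetric])
    then show ?thesis using quadratic_form_le_lambda_max[OF symA] by (simp add: c)
  qed
  then show ?thesis
    unfolding norm_mat_eq_columns sum_distrib_left by (intro sum_mono)
qed

text \<open>Each of the two factors \<open>R\<close> costs the square root of
  \<open>lambda_max A\<close>; the right factor is moved to the left by transposition.\<close>

lemma norm_sqrt_conj_le:
  fixes A R M :: "real^'n^'n"
  assumes A: "pos_def_mat A" and R: "transpose R = R" "R ** R = A"
  shows "norm (R ** M ** R) \<le> lambda_max A * norm M"
proof -
  let ?l = "lambda_max A"
  have l: "?l > 0" by (rule pos_def_lambda_max_pos[OF A])
  have "(norm (R ** M ** R))\<^sup>2 = (norm (R ** transpose (R ** M)))\<^sup>2"
    using norm_transpose[of "R ** M ** R"] by (simp add: matrix_transpose_mul R)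
  also have "\<dots> \<le> ?l * (norm (R ** M))\<^sup>2"
    using norm_sqrt_mult_le[OF R, of "transpose (R ** M)"] by (simp only: norm_transpose)
  also have "\<dots> \<le> ?l * (?l * (norm M)\<^sup>2)"
    using l by (intro mult_left_mono norm_sqrt_mult_le[OF R]) auto
  also have "\<dots> = (?l * norm M)\<^sup>2" by (simp add: power2_eq_square)
  finally show ?thesis by (rule power2_le_imp_le) (use l in simp)
qed

lemma pos_def_norm_le:
  fixes A :: "real^'n^'n"
  assumes A: "pos_def_mat A"
  shows "(norm A)\<^sup>2 \<le> real CARD('n) * (lambda_max A)\<^sup>2"
proof -
  obtain R where R: "transpose R = R" "R ** R = A" "invertible R"
    using pos_def_mat_sqrt[OF A] .
  have "norm A \<le> lambda_max A * norm (mat 1 :: real^'n^'n)"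
    using norm_sqrt_conj_le[OF A R(1,2), of "mat 1"] by (simp add: R)
  then have "(norm A)\<^sup>2 \<le> (lambda_max A * norm (mat 1 :: real^'n^'n))\<^sup>2"
    by (intro power_mono) auto
  then show ?thesis by (simp add: power_mult_distrib norm_mat_one mult.commute)
qed

lemma mat_nth_eq_inner: "(A :: real^'n^'n) $ j $ k = axis j 1 \<bullet> (A *v axis k 1)"
  by (simp add: inner_axis' matrix_vector_mult_basis column_def)

text \<open>An entry of \<open>A\<close> is the inner product of two columns of the root
  \<open>R\<close>, each of length at most the square root of \<open>lambda_max A\<close>.\<close>

lemma pos_def_entry_le:
  fixes A :: "real^'n^'n"
  assumes A: "pos_def_mat A"
  shows "\<bar>A $ j $ k\<bar> \<le> lambda_max A"
proof -
  obtain R where R: "transpose R = R" "R ** R = A" "invertible R"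
    using pos_def_mat_sqrt[OF A] .
  have symA: "transpose A = A" using A by (simp add: pos_def_mat_def)
  have RA: "x \<bullet> (A *v y) = (R *v x) \<bullet> (R *v y)" for x y
    unfolding R(2)[symmetric] matrix_vector_mul_assoc[symmetric]
    by (rule inner_symmetric_matrix[OF R(1)])
  have n: "norm (R *v axis i 1) \<le> sqrt (lambda_max A)" for i
    using quadratic_form_le_lambda_max[OF symA, of "axis i 1"]
    by (simp add: RA norm_eq_sqrt_inner inner_axis_axis)
  have "\<bar>A $ j $ k\<bar> \<le> norm (R *v axis j 1) * norm (R *v axis k 1)"
    unfolding mat_nth_eq_inner RA by (rule Cauchy_Schwarz_ineq2)
  also have "\<dots> \<le> sqrt (lambda_max A) * sqrt (lambda_max A)"
    by (intro mult_mono n) (use pos_def_lambda_max_pos[OF A] in auto)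
  finally show ?thesis using pos_def_lambda_max_pos[OF A] by simp
qed

lemma sigma2_max_ge: "matrix_inv A $ j $ j \<le> sigma2_max A"
  unfolding sigma2_max_def by (intro Max_ge) auto

text \<open>The weighted Cauchy-Schwarz inequality at a coordinate vector. It forces
  \<open>C \<ge> 1\<close> in the final theorem, which keeps the deviation level there below
  1.\<close>

lemma sigma2_max_lambda_max_ge_1:
  fixes A :: "real^'n^'n"
  assumes A: "pos_def_mat A"
  shows "1 \<le> sigma2_max A * lambda_max A" "0 < sigma2_max A"
proof -
  fix j :: 'n
  let ?e = "axis j (1::real)"
  have s: "0 < matrix_inv A $ j $ j"
    unfolding mat_nth_eq_inner by (rule pos_def_matrix_inv_pos[OF A]) (simp add: axis_eq_0_iff)
  then show "0 < sigma2_max A" using sigma2_max_ge[of A j] by linarith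
  have "1 \<le> (matrix_inv A $ j $ j) * (A $ j $ j)"
    using pos_def_cauchy_schwarz[OF A, of ?e ?e] by (simp add: mat_nth_eq_inner inner_axis_axis)
  also have "\<dots> \<le> (matrix_inv A $ j $ j) * lambda_max A"
    using s pos_def_entry_le[OF A, of j j] by (intro mult_left_mono) auto
  also have "\<dots> \<le> sigma2_max A * lambda_max A"
    using pos_def_lambda_max_pos[OF A] by (intro mult_right_mono sigma2_max_ge) auto
  finally show "1 \<le> sigma2_max A * lambda_max A" .
qed

text \<open>For \<open>m \<ge> 0\<close> the second-order bound on \<open>ln\<close> gives the
  estimate with \<open>m\<close> in the denominator; for negative \<open>m\<close> even
  \<open>m\<^sup>2 / 2\<close> is a lower bound. Using a common \<open>x\<close> lets the estimates
  be summed over eigenvalues.\<close>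

lemma minus_ln_one_plus_ge:
  assumes m: "1 + (m::real) > 0" "\<bar>m\<bar> \<le> x"
  shows "m\<^sup>2 / (2 * (1 + x)) \<le> m - ln (1 + m)"
proof (cases "m \<ge> 0")
  case True
  have "ln (1 + m) \<le> (1 + m - 1 / (1 + m)) / 2"
    using True by (intro ln_le_half_diff_inverse) auto
  moreover have "m - (1 + m - 1 / (1 + m)) / 2 = m\<^sup>2 / (2 * (1 + m))"
    using True by (simp add: field_simps power2_eq_square)
  moreover have "m\<^sup>2 / (2 * (1 + x)) \<le> m\<^sup>2 / (2 * (1 + m))"
    using True m by (intro divide_left_mono mult_pos_pos) auto
  ultimately show ?thesis by linarith
next
  case False
  define f where "f t = t - ln (1 + t) - t\<^sup>2 / 2" for t :: real
  have "f 0 \<le> f m"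
  proof (rule DERIV_nonpos_imp_nonincreasing[of m 0 f])
    show "m \<le> 0" using False by simp
    fix t :: real assume t: "m \<le> t" "t \<le> 0"
    have "(f has_real_derivative (1 - 1 / (1 + t) - t)) (at t)"
      unfolding f_def using t m by (auto intro!: derivative_eq_intros)
    moreover have "1 - 1 / (1 + t) - t = - (t\<^sup>2 / (1 + t))"
      using t m by (simp add: field_simps power2_eq_square)
    moreover have "t\<^sup>2 / (1 + t) \<ge> 0" using t m by auto
    ultimately show "\<exists>y. (f has_real_derivative y) (at t) \<and> y \<le> 0" by auto
  qed
  then have "m\<^sup>2 / 2 \<le> m - ln (1 + m)" by (simp add: f_def)
  moreover have "m\<^sup>2 / (2 * (1 + x)) \<le> m\<^sup>2 / 2"
    using m by (intro divide_left_mono mult_pos_pos) auto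
  ultimately show ?thesis by linarith
qed

text \<open>The witness x is the Frobenius norm of \<open>A\<^sup>-\<^sup>1\<^sup>/\<^sup>2 (B - A) A\<^sup>-\<^sup>1\<^sup>/\<^sup>2\<close>.\<close>
lemma gaussian_divergence_ge:
  fixes A B :: "real^'n^'n"
  assumes A: "pos_def_mat A" and B: "pos_def_mat B"
  obtains x where "x \<ge> 0" "norm (B - A) \<le> lambda_max A * x"
    "x\<^sup>2 / (2 * (1 + x)) \<le> trace (matrix_inv A ** (B - A)) - (ln (det B) - ln (det A))"
proof -
  obtain R where R: "transpose R = R" "R ** R = A" "invertible R"
    using pos_def_mat_sqrt[OF A] .
  note inv = matrix_inv_sqrt[OF R]
  note Rinv = matrix_inv[OF R(3)]
  define D where "D = B - A"
  define M where "M = matrix_inv R ** D ** matrix_inv R"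
  have symD: "transpose D = D"
    using A B by (simp add: D_def pos_def_mat_def transpose_def vec_eq_iff)
  have "transpose M = M" by (simp add: M_def matrix_transpose_mul inv symD matrix_mul_assoc)
  then obtain Q \<mu> where Q: "orthogonal_matrix Q" and M: "M = Q ** diag_mat \<mu> ** transpose Q"
    by (rule symmetric_diagonalizable)
  have D: "D = R ** M ** R"
  proof -
    have "R ** M ** R = (R ** matrix_inv R) ** D ** (matrix_inv R ** R)"
      by (simp only: M_def matrix_mul_assoc)
    then show ?thesis by (simp add: Rinv)
  qed
  have I: "mat 1 + M = Q ** diag_mat (\<lambda>i. 1 + \<mu> i) ** transpose Q"
  proof -
    have "diag_mat (\<lambda>i. 1 + \<mu> i) = mat 1 + diag_mat \<mu>"
      by (simp add: diag_mat_one[symmetric] diag_mat_add)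
    then have "Q ** diag_mat (\<lambda>i. 1 + \<mu> i) ** transpose Q = Q ** transpose Q + M"
      by (simp add: M matrix_add_ldistrib matrix_add_rdistrib)
    then show ?thesis using Q by (simp add: orthogonal_matrix_def)
  qed
  have Bf: "B = R ** (mat 1 + M) ** R"
  proof -
    have "R ** (mat 1 + M) ** R = R ** R + D"
      by (simp add: D matrix_add_ldistrib matrix_add_rdistrib)
    then show ?thesis by (simp add: R D_def)
  qed
  \<comment> \<open>These are the eigenvalues of \<open>B\<close> after congruence with the inverse
    root of \<open>A\<close>; the quadratic form of \<open>B\<close> at \<open>y\<close> equals
    \<open>1 + \<mu> i\<close>.\<close>
  have pos: "1 + \<mu> i > 0" for i
  proof -
    define y where "y = matrix_inv R *v (Q *v axis i 1)"
    have Ry: "R *v y = Q *v axis i 1" by (simp add: y_def matrix_vector_mul_assoc Rinv matrix_mul_assoc)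
    have "y \<noteq> 0"
    proof
      assume "y = 0"
      then have "Q *v axis i 1 = 0" using Ry by simp
      then have "axis i (1::real) = 0" using orthogonal_matrix_cancel(1)[OF Q, of "axis i 1"] by simp
      then show False by (simp add: axis_eq_0_iff)
    qed
    then have "0 < y \<bullet> (B *v y)" using B by (simp add: pos_def_mat_def)
    also have "\<dots> = (R *v y) \<bullet> ((mat 1 + M) *v (R *v y))"
      unfolding Bf matrix_vector_mul_assoc[symmetric] by (rule inner_symmetric_matrix[OF R(1)])
    also have "\<dots> = (\<Sum>k\<in>UNIV. if k = i then 1 + \<mu> i else 0)"
      unfolding Ry I quadratic_form_diagonalized orthogonal_matrix_cancel[OF Q]
      by (intro sum.cong) (auto simp: axis_def)
    finally show ?thesis by simp
  qed
  have detB: "ln (det B) - ln (det A) = (\<Sum>i\<in>UNIV. ln (1 + \<mu> i))"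
  proof -
    have "det B = det A * (\<Prod>i\<in>UNIV. 1 + \<mu> i)"
    proof -
      have "det (mat 1 + M) = (\<Prod>i\<in>UNIV. 1 + \<mu> i)"
        unfolding I by (simp only: det_orthogonal_conj[OF Q] det_diag_mat)
      then show ?thesis by (simp add: Bf R(2)[symmetric] det_mul)
    qed
    moreover have "0 < (\<Prod>i\<in>UNIV. 1 + \<mu> i)" using pos by (intro prod_pos) auto
    ultimately have "ln (det B) = ln (det A) + ln (\<Prod>i\<in>UNIV. 1 + \<mu> i)"
      using ln_mult_pos[OF det_pos_def[OF A]] by simp
    moreover have "1 + \<mu> i \<noteq> 0" for i using pos[of i] by simp
    ultimately show ?thesis by (simp add: ln_prod)
  qed
  have tr_conj: "trace (Q ** W ** transpose Q) = trace W" for W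
  proof -
    have "trace (Q ** W ** transpose Q) = trace (transpose Q ** (Q ** W))" by (rule trace_mul_sym)
    also have "\<dots> = trace W" using Q by (simp add: matrix_mul_assoc orthogonal_matrix)
    finally show ?thesis .
  qed
  have tr: "trace (matrix_inv A ** D) = (\<Sum>i\<in>UNIV. \<mu> i)"
  proof -
    have "trace (matrix_inv A ** D) = trace (matrix_inv R ** (matrix_inv R ** D))"
      by (simp add: inv matrix_mul_assoc)
    also have "\<dots> = trace M"
      unfolding M_def by (rule trace_mul_sym)
    finally show ?thesis by (simp add: M tr_conj)
  qed
  have nM: "(norm M)\<^sup>2 = (\<Sum>i\<in>UNIV. (\<mu> i)\<^sup>2)"
  proof -
    have "(norm M)\<^sup>2 = trace (transpose M ** M)"
      unfolding norm_mat_eq_columns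
      by (simp add: trace_def matrix_matrix_mult_def column_def inner_vec_def transpose_def)
    also have "transpose M ** M = Q ** diag_mat \<mu> ** (transpose Q ** Q) ** diag_mat \<mu> ** transpose Q"
      unfolding \<open>transpose M = M\<close> by (simp only: M matrix_mul_assoc)
    also have "\<dots> = Q ** (diag_mat \<mu> ** diag_mat \<mu>) ** transpose Q"
      using Q by (simp add: orthogonal_matrix matrix_mul_assoc del: diag_mat_mult)
    finally show ?thesis by (simp add: tr_conj power2_eq_square)
  qed
  \<comment> \<open>The Frobenius norm dominates every eigenvalue, so one denominator
    \<open>1 + norm M\<close> serves all summands.\<close>
  have "\<bar>\<mu> i\<bar> \<le> norm M" for i
  proof -
    have "(\<mu> i)\<^sup>2 \<le> (norm M)\<^sup>2" unfolding nM by (rule member_le_sum) auto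
    then show ?thesis using abs_le_square_iff[of "\<mu> i" "norm M"] by simp
  qed
  then have "(\<Sum>i\<in>UNIV. (\<mu> i)\<^sup>2 / (2 * (1 + norm M))) \<le> (\<Sum>i\<in>UNIV. \<mu> i - ln (1 + \<mu> i))"
    by (intro sum_mono minus_ln_one_plus_ge pos)
  then have "(norm M)\<^sup>2 / (2 * (1 + norm M)) \<le> trace (matrix_inv A ** D) - (ln (det B) - ln (det A))"
    by (simp add: nM tr detB sum_subtractf sum_divide_distrib)
  moreover have "norm D \<le> lambda_max A * norm M"
    unfolding D by (rule norm_sqrt_conj_le[OF A R(1,2)])
  ultimately show ?thesis using that[of "norm M"] by (simp add: D_def)
qed

section \<open>Noise on a sparse support, edge counts and the minimal edge weight\<close>

lemma trace_mult_symmetric: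
  fixes A D :: "real^'n^'n"
  assumes "transpose D = D"
  shows "trace (A ** D) = A \<bullet> D"
proof -
  have "D $ j $ k = transpose D $ k $ j" for j k
    by (simp add: transpose_def)
  then have "D $ j $ k = D $ k $ j" for j k
    by (simp add: assms)
  then show ?thesis
    unfolding trace_def matrix_matrix_mult_def inner_mat_eq_sum
    by (auto intro!: sum.cong)
qed

text \<open>Cauchy-Schwarz restricted to the support of \<open>D\<close>: only the number of nonzero
  entries enters, not the full matrix size.\<close>

lemma inner_bounded_support_le:
  fixes Z D :: "real^'n^'n"
  assumes Z: "\<And>j k. \<bar>Z $ j $ k\<bar> \<le> h"
    and supp: "card {(j, k). D $ j $ k \<noteq> 0} \<le> m"
  shows "\<bar>Z \<bullet> D\<bar> \<le> h * sqrt (real m) * norm D"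
proof -
  have h: "h \<ge> 0" using order_trans[OF abs_ge_zero Z] by blast
  define P where "P = {(j, k). D $ j $ k \<noteq> 0}"
  have sumP: "(\<Sum>j\<in>UNIV. \<Sum>k\<in>UNIV. g j k) = (\<Sum>(j, k)\<in>P. g j k)"
    if "\<And>j k. D $ j $ k = 0 \<Longrightarrow> g j k = 0" for g :: "'n \<Rightarrow> 'n \<Rightarrow> real"
    unfolding sum.cartesian_product using that
    by (intro sum.mono_neutral_right) (auto simp: P_def)
  have "\<bar>Z \<bullet> D\<bar> = \<bar>\<Sum>(j, k)\<in>P. Z $ j $ k * D $ j $ k\<bar>"
    unfolding inner_mat_eq_sum by (subst sumP) auto
  also have "\<dots> \<le> (\<Sum>(j, k)\<in>P. h * \<bar>D $ j $ k\<bar>)"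
    by (rule order_trans[OF sum_abs]) (auto intro!: sum_mono mult_right_mono Z simp: abs_mult split_beta)
  also have "\<dots> = h * (\<Sum>(j, k)\<in>P. 1 * \<bar>D $ j $ k\<bar>)"
    by (simp add: sum_distrib_left split_beta)
  also have "\<dots> \<le> h * (sqrt (real m) * norm D)"
  proof (rule mult_left_mono[OF _ h])
    have "(\<Sum>p\<in>P. 1 * \<bar>D $ fst p $ snd p\<bar>) \<le> L2_set (\<lambda>_. 1) P * L2_set (\<lambda>p. D $ fst p $ snd p) P"
      using L2_set_mult_ineq[of "\<lambda>_. 1" "\<lambda>p. D $ fst p $ snd p" P] by simp
    also have "L2_set (\<lambda>p. D $ fst p $ snd p) P = norm D"
      unfolding L2_set_def norm_eq_sqrt_inner inner_mat_eq_sum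
      by (subst sumP) (auto simp: split_beta power2_eq_square)
    also have "L2_set (\<lambda>_. 1) P * norm D \<le> sqrt (real m) * norm D"
      using supp by (intro mult_right_mono) (auto simp: L2_set_def P_def)
    finally show "(\<Sum>(j, k)\<in>P. 1 * \<bar>D $ j $ k\<bar>) \<le> sqrt (real m) * norm D"
      by (simp add: split_beta)
  qed
  finally show ?thesis by (simp add: mult.assoc)
qed

lemma card_edge_pairs_le:
  fixes E :: "'n::finite set set"
  assumes "edge_set E"
  shows "card {(j, k). {j, k} \<in> E} \<le> 2 * card E"
proof -
  have "{(j, k). {j, k} \<in> E} = (\<Union>e\<in>E. {(j, k). {j, k} = e})" by auto
  then have "card {(j, k). {j, k} \<in> E} \<le> (\<Sum>e\<in>E. card {(j, k). {j, k} = e})"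
    by (simp add: card_UN_le)
  also have "\<dots> \<le> (\<Sum>e\<in>E. 2)"
  proof (rule sum_mono)
    fix e assume "e \<in> E"
    then obtain a b where e: "e = {a, b}" using assms by (auto simp: edge_set_def)
    have "{(j, k). {j, k} = e} \<subseteq> {(a, b), (b, a)}" unfolding e doubleton_eq_iff by blast
    then have "card {(j, k). {j, k} = e} \<le> card {(a, b), (b, a)}" by (intro card_mono) auto
    also have "\<dots> \<le> 2" using card_length[of "[(a, b), (b, a)]"] by simp
    finally show "card {(j, k). {j, k} = e} \<le> 2" .
  qed
  finally show ?thesis by (simp add: mult.commute)
qed

lemma theta_min_le:
  fixes A :: "real^'n^'n"
  shows "{j, k} \<in> E \<Longrightarrow> theta_min E A \<le> \<bar>A $ j $ k\<bar>"
  unfolding theta_min_def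
proof (rule Min_le)
  have "{\<bar>A $ j $ k\<bar> |j k. {j, k} \<in> E} \<subseteq> range (\<lambda>(j, k). \<bar>A $ j $ k\<bar>)" by auto
  then show "finite {\<bar>A $ j $ k\<bar> |j k. {j, k} \<in> E}" by (rule finite_subset) simp
qed auto

text \<open>For a nonempty edge set the minimum is over a finite nonempty set; for the empty one
  \<open>theta_min\<close> would be the unspecified \<open>Min {}\<close>.\<close>

lemma theta_min_attained:
  fixes A :: "real^'n^'n"
  assumes "edge_set E" "E \<noteq> {}"
  obtains j k where "{j, k} \<in> E" "theta_min E A = \<bar>A $ j $ k\<bar>"
proof -
  have "{\<bar>A $ j $ k\<bar> |j k. {j, k} \<in> E} \<subseteq> range (\<lambda>(j, k). \<bar>A $ j $ k\<bar>)" by auto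
  then have "finite {\<bar>A $ j $ k\<bar> |j k. {j, k} \<in> E}" by (rule finite_subset) simp
  moreover obtain e where e: "e \<in> E" using assms(2) by auto
  then obtain a b where "e = {a, b}" using assms(1) by (auto simp: edge_set_def)
  then have "{\<bar>A $ j $ k\<bar> |j k. {j, k} \<in> E} \<noteq> {}" using e by auto
  ultimately have "theta_min E A \<in> {\<bar>A $ j $ k\<bar> |j k. {j, k} \<in> E}"
    unfolding theta_min_def by (rule Min_in)
  then show ?thesis using that by auto
qed

text \<open>Here y is the signal-to-scale ratio, x the size of the increment, N the number of
  missed edges (as ordered pairs) and d the noise level per coordinate; the noise lives on
  at most k + N coordinates.\<close>
lemma signal_dominates_noise:
  fixes x y N k d :: real
  assumes x: "x \<ge> 0" and y: "0 \<le> y" "y \<le> 1" and N: "N \<ge> 1" "N * y\<^sup>2 \<le> x\<^sup>2" "N * y\<^sup>2 \<le> k"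
    and k: "k \<ge> 4" and d: "d \<ge> 0" "d\<^sup>2 * k \<le> y\<^sup>2 / 80"
  shows "y\<^sup>2 / 12 \<le> x\<^sup>2 / (2 * (1 + x)) - d * sqrt (k + N) * x"
proof -
  \<comment> \<open>The squared noise splits into a part of size \<open>y\<^sup>2\<close> and a part
    \<open>z\<close> due to the missed edges.\<close>
  define z where "z = N * y\<^sup>2 / k"
  have d2: "(d * sqrt (k + N))\<^sup>2 \<le> (y\<^sup>2 + z) / 80"
  proof -
    have "(d * sqrt (k + N))\<^sup>2 = d\<^sup>2 * k * (1 + N / k)"
      using k N by (simp add: power_mult_distrib field_simps)
    also have "\<dots> \<le> y\<^sup>2 / 80 * (1 + N / k)"
      using k N d by (intro mult_right_mono) auto
    finally show ?thesis by (simp add: z_def field_simps)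
  qed
  have yx: "y\<^sup>2 \<le> x\<^sup>2" using N(1,2) mult_right_mono[of 1 N "y\<^sup>2"] by simp
  show ?thesis
  \<comment> \<open>The two upper bounds on \<open>N * y\<^sup>2\<close> serve the two regimes. For
    small \<open>x\<close> they give \<open>z \<le> x\<^sup>2 / 4\<close>, signal at least
    \<open>x\<^sup>2 / 4\<close> and noise at most \<open>x\<^sup>2 / 6\<close>; for large
    \<open>x\<close> they give \<open>z \<le> 1\<close>, signal at least \<open>x / 4\<close> and
    noise at most \<open>x / 6\<close>. The difference 1/4 - 1/6 is the 1/12 of the claim.\<close>
  proof (cases "x \<le> 1")
    case True
    have z: "z \<le> x\<^sup>2 / 4"
      unfolding z_def using N k by (intro frac_le) auto
    have "(a + b) / 80 \<le> c / 36" if "b \<le> c / 4" "a \<le> c" "0 \<le> c" for a b c :: real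
    proof -
      have "36 * (a + b) \<le> 80 * c" using that by argo
      then show ?thesis by (simp add: field_simps)
    qed
    from this[OF z yx zero_le_power2] have "(y\<^sup>2 + z) / 80 \<le> x\<^sup>2 / 36" .
    then have "(y\<^sup>2 + z) / 80 \<le> (x / 6)\<^sup>2" by (simp add: power_divide)
    then have "(d * sqrt (k + N))\<^sup>2 \<le> (x / 6)\<^sup>2" using d2 by (rule order_trans[rotated])
    then have "d * sqrt (k + N) \<le> x / 6" by (rule power2_le_imp_le) (use x in auto)
    then have "d * sqrt (k + N) * x \<le> x / 6 * x" using x by (rule mult_right_mono)
    then have n: "d * sqrt (k + N) * x \<le> x\<^sup>2 / 6" by (simp add: power2_eq_square)
    have s: "x\<^sup>2 / 4 \<le> x\<^sup>2 / (2 * (1 + x))"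
      using x True by (intro divide_left_mono) auto
    have "a / 12 \<le> r - m" if "m \<le> b / 6" "b / 4 \<le> r" "a \<le> b" for a b r m :: real
      using that by argo
    from this[OF n s yx] show ?thesis .
  next
    case False
    have "z \<le> 1" using N k by (simp add: z_def divide_le_eq)
    moreover have "y\<^sup>2 \<le> 1" using y by (simp add: power_le_one)
    ultimately have "(d * sqrt (k + N))\<^sup>2 \<le> (1 / 6)\<^sup>2"
      using d2 by (simp add: power_divide)
    then have "d * sqrt (k + N) \<le> 1 / 6" by (rule power2_le_imp_le) auto
    then have "d * sqrt (k + N) * x \<le> 1 / 6 * x" using x by (rule mult_right_mono)
    moreover have "x / 4 \<le> x\<^sup>2 / (2 * (1 + x))"
      using False by (simp add: field_simps power2_eq_square)
    moreover have "y\<^sup>2 \<le> x" using \<open>y\<^sup>2 \<le> 1\<close> False by linarith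
    ultimately show ?thesis by linarith
  qed
qed

text \<open>The deterministic core: \<open>signal_dominates_noise\<close> is applied with
  \<open>y\<close> the ratio of \<open>theta_min\<close> to \<open>lambda_max\<close>,
  \<open>d = h * lambda_max A\<close> and \<open>k\<close> equal to the number of nodes plus
  \<open>2 * q\<close>. The factor \<open>n / 24\<close> is \<open>n / 2\<close> times 1/12.\<close>

lemma loglik_diff_ge:
  fixes A B S :: "real^'n^'n" and E E0 :: "'n set set"
  assumes A: "pos_def_mat A" and E0: "edge_set E0"
    and AE0: "\<And>j k. A $ j $ k \<noteq> 0 \<longleftrightarrow> (j = k \<or> {j, k} \<in> E0)"
    and E: "edge_set E" "\<not> E0 \<subseteq> E" "card E \<le> q" and B: "in_model E B"
    and S: "\<And>j k. \<bar>S $ j $ k - matrix_inv A $ j $ k\<bar> \<le> h"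
    and h: "(h * lambda_max A)\<^sup>2 * (real CARD('n) + 2 * real q) \<le> (theta_min E0 A / lambda_max A)\<^sup>2 / 80"
    and k4: "real CARD('n) + 2 * real q \<ge> 4"
  shows "real n / 24 * (theta_min E0 A / lambda_max A)\<^sup>2 \<le> loglik n S A - loglik n S B"
proof -
  let ?l = "lambda_max A" and ?t = "theta_min E0 A"
  define k where "k = CARD('n) + 2 * q"
  define D where "D = B - A"
  have pB: "pos_def_mat B" using B by (simp add: in_model_def)
  have l: "?l > 0" by (rule pos_def_lambda_max_pos[OF A])
  have h0: "h \<ge> 0" using order_trans[OF abs_ge_zero S] by blast
  have symD: "transpose D = D"
    using A pB by (simp add: D_def pos_def_mat_def transpose_def vec_eq_iff)
  obtain x where x: "x \<ge> 0" "norm D \<le> ?l * x"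
    "x\<^sup>2 / (2 * (1 + x)) \<le> trace (matrix_inv A ** D) - (ln (det B) - ln (det A))"
    using gaussian_divergence_ge[OF A pB] unfolding D_def by blast
  define NP where "NP = {(j, k). {j, k} \<in> E0 - E}"
  obtain e where e: "e \<in> E0" "e \<notin> E" using E(2) by auto
  then have "E0 \<noteq> {}" by auto
  then obtain a b where ab: "{a, b} \<in> E0" "?t = \<bar>A $ a $ b\<bar>"
    using theta_min_attained[OF E0] by metis
  have t: "0 \<le> ?t" "?t \<le> ?l" using ab pos_def_entry_le[OF A] by auto
  have N1: "card NP \<ge> 1"
  proof -
    obtain j k where "e = {j, k}" using e E0 by (auto simp: edge_set_def)
    then have "(j, k) \<in> NP" using e by (auto simp: NP_def)
    then have "NP \<noteq> {}" by auto
    then show ?thesis by (simp add: card_gt_0_iff Suc_le_eq)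
  qed
  \<comment> \<open>Kept general in \<open>C\<close> because it is used twice: for the increment
    \<open>D\<close>, which equals \<open>- A\<close> on missed edges, and for \<open>A\<close>
    itself.\<close>
  have NPA: "real (card NP) * ?t\<^sup>2 \<le> (norm C)\<^sup>2"
    if C: "\<And>j k. {j, k} \<in> E0 - E \<Longrightarrow> \<bar>C $ j $ k\<bar> = \<bar>A $ j $ k\<bar>" for C :: "real^'n^'n"
  proof -
    have "real (card NP) * ?t\<^sup>2 = (\<Sum>(j, k)\<in>NP. ?t\<^sup>2)" by simp
    also have "\<dots> \<le> (\<Sum>(j, k)\<in>NP. C $ j $ k * C $ j $ k)"
    proof (rule sum_mono, clarify)
      fix j k assume "(j, k) \<in> NP"
      then have jk: "{j, k} \<in> E0 - E" by (simp add: NP_def)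
      then have "?t \<le> \<bar>C $ j $ k\<bar>" using theta_min_le[of j k E0 A] C[OF jk] by simp
      then have "?t\<^sup>2 \<le> \<bar>C $ j $ k\<bar>\<^sup>2" using t by (intro power_mono) auto
      then show "?t\<^sup>2 \<le> C $ j $ k * C $ j $ k" by (simp add: power2_eq_square)
    qed
    also have "\<dots> \<le> (\<Sum>(j, k)\<in>UNIV. C $ j $ k * C $ j $ k)"
      by (rule sum_mono2) auto
    also have "\<dots> = (norm C)\<^sup>2"
      unfolding power2_norm_eq_inner inner_mat_eq_sum sum.cartesian_product by simp
    finally show ?thesis .
  qed
  have ND: "real (card NP) * ?t\<^sup>2 \<le> (norm D)\<^sup>2"
  proof (rule NPA)
    fix j k assume jk: "{j, k} \<in> E0 - E"
    then have "j \<noteq> k" using E0 by (auto simp: edge_set_def)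
    then have "B $ j $ k = 0" using jk B by (auto simp: in_model_def)
    then show "\<bar>D $ j $ k\<bar> = \<bar>A $ j $ k\<bar>" by (simp add: D_def)
  qed
  \<comment> \<open>Off the diagonal and outside \<open>E\<close> the entry of \<open>B\<close> is
    zero, so a nonzero increment there comes from \<open>A\<close> and marks a missed edge.\<close>
  have supp: "card {(j, k). D $ j $ k \<noteq> 0} \<le> k + card NP"
  proof -
    have "{(j, k). D $ j $ k \<noteq> 0} \<subseteq> range (\<lambda>j. (j, j)) \<union> {(j, k). {j, k} \<in> E} \<union> NP"
    proof
      fix z assume z: "z \<in> {(j, k). D $ j $ k \<noteq> 0}"
      obtain j k where jk: "z = (j, k)" by (cases z)
      show "z \<in> range (\<lambda>j. (j, j)) \<union> {(j, k). {j, k} \<in> E} \<union> NP"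
      proof (rule ccontr)
        assume "z \<notin> range (\<lambda>j. (j, j)) \<union> {(j, k). {j, k} \<in> E} \<union> NP"
        then have *: "D $ j $ k \<noteq> 0" "(j, k) \<notin> NP" "{j, k} \<notin> E" and "j \<noteq> k"
          using z by (auto simp: jk)
        then have "B $ j $ k = 0" using * B by (auto simp: in_model_def)
        then have "A $ j $ k \<noteq> 0" using * by (simp add: D_def)
        then show False using AE0[of j k] * \<open>j \<noteq> k\<close> by (simp add: NP_def)
      qed
    qed
    then have "card {(j, k). D $ j $ k \<noteq> 0} \<le> card (range (\<lambda>j::'n. (j, j)) \<union> {(j, k). {j, k} \<in> E} \<union> NP)"
      by (intro card_mono) auto
    also have "\<dots> \<le> card (range (\<lambda>j::'n. (j, j))) + card {(j, k). {j, k} \<in> E} + card NP"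
      by (meson add_right_mono card_Un_le order_trans)
    also have "\<dots> \<le> CARD('n) + 2 * q + card NP"
      using card_edge_pairs_le[OF E(1)] E(3) card_image_le[of "UNIV :: 'n set" "\<lambda>j. (j, j)"]
      by (intro add_mono) auto
    finally show ?thesis by (simp add: k_def)
  qed
  define y where "y = ?t / ?l"
  have y: "0 \<le> y" "y \<le> 1" using t l by (auto simp: y_def)
  have signal: "y\<^sup>2 / 12 \<le> x\<^sup>2 / (2 * (1 + x)) - h * ?l * sqrt (real k + real (card NP)) * x"
  proof (rule signal_dominates_noise[OF x(1) y])
    show "1 \<le> real (card NP)" using N1 by simp
    have "real (card NP) * ?t\<^sup>2 \<le> (?l * x)\<^sup>2"
      using ND power_mono[OF x(2) norm_ge_zero, of 2] by linarith
    then show "real (card NP) * y\<^sup>2 \<le> x\<^sup>2"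
      using l by (simp add: y_def power_divide power_mult_distrib divide_le_eq mult.commute)
    have "real (card NP) * ?t\<^sup>2 \<le> real k * ?l\<^sup>2"
      using NPA[of A] pos_def_norm_le[OF A] mult_right_mono[of "real CARD('n)" "real k" "?l\<^sup>2"]
      by (simp add: k_def)
    then show "real (card NP) * y\<^sup>2 \<le> real k"
      using l by (simp add: y_def power_divide divide_le_eq)
    show "real k \<ge> 4" using k4 by (simp add: k_def)
    show "0 \<le> h * ?l" using h0 l by simp
    show "(h * ?l)\<^sup>2 * real k \<le> y\<^sup>2 / 80" using h by (simp add: k_def y_def)
  qed
  have noise: "\<bar>(S - matrix_inv A) \<bullet> D\<bar> \<le> h * ?l * sqrt (real k + real (card NP)) * x"
  proof -
    have "\<bar>(S - matrix_inv A) \<bullet> D\<bar> \<le> h * sqrt (real (k + card NP)) * norm D"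
      using S by (intro inner_bounded_support_le supp) simp
    also have "\<dots> \<le> h * sqrt (real (k + card NP)) * (?l * x)"
      using h0 by (intro mult_left_mono x) auto
    finally show ?thesis by (simp add: mult_ac)
  qed
  have "trace (S ** B) - trace (S ** A) = trace (S ** D)"
    by (simp add: D_def trace_sub[symmetric] matrix_diff_ldistrib)
  also have "\<dots> = (S - matrix_inv A) \<bullet> D + trace (matrix_inv A ** D)"
    by (simp add: trace_mult_symmetric[OF symD] inner_diff_left)
  finally have tr: "trace (S ** B) - trace (S ** A) = (S - matrix_inv A) \<bullet> D + trace (matrix_inv A ** D)" .
  have "loglik n S A - loglik n S B = real n / 2 * (ln (det A) - ln (det B) + (trace (S ** B) - trace (S ** A)))"
    by (simp add: loglik_def algebra_simps diff_divide_distrib)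
  moreover have "y\<^sup>2 / 12 \<le> ln (det A) - ln (det B) + (trace (S ** B) - trace (S ** A))"
    using signal noise x(3) unfolding tr by linarith
  then have "real n / 2 * (y\<^sup>2 / 12) \<le> real n / 2 * (ln (det A) - ln (det B) + (trace (S ** B) - trace (S ** A)))"
    by (intro mult_left_mono) auto
  ultimately show ?thesis by (simp add: y_def)
qed

section \<open>Measurability and probability bounds\<close>

lemma continuous_loglik: "continuous_on UNIV (\<lambda>S. loglik n S B)"
  unfolding loglik_def trace_def matrix_matrix_mult_def
  by (auto intro!: continuous_intros)

lemma borel_measurable_loglik [measurable]: "(\<lambda>S. loglik n S B) \<in> borel_measurable borel"
  by (rule borel_measurable_continuous_onI[OF continuous_loglik])

text \<open>The supremum ranges over an uncountable family, so measurability comes from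
  lower semicontinuity.\<close>
lemma borel_measurable_loglik_mle [measurable]:
  "(\<lambda>S. loglik_mle n S E) \<in> borel_measurable borel"
proof (rule borel_measurableI_greater)
  fix y :: ereal
  have "{S. y < loglik_mle n S E} = (\<Union>B\<in>{B. in_model E B}. {S. y < ereal (loglik n S B)})"
    by (auto simp: loglik_mle_def less_SUP_iff)
  moreover have "open {S. y < ereal (loglik n S B)}" for B
    by (intro open_Collect_less continuous_on_const continuous_on_ereal continuous_loglik)
  ultimately have "open {S. y < loglik_mle n S E}" by auto
  then show "{S \<in> space borel. y < loglik_mle n S E} \<in> sets borel" by simp
qed

lemma borel_measurable_outer [measurable]: "outer \<in> borel_measurable borel"
  unfolding outer_def by (intro borel_measurable_continuous_onI continuous_intros)

lemma sample_cov_eq_outer: "sample_cov n X = (1 / real n) *\<^sub>R (\<Sum>i<n. outer (X i))"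
  by (simp add: sample_cov_def outer_def)

lemma sample_cov_measurable [measurable]:
  "sample_cov n \<in> borel_measurable (sample_law n A)"
proof -
  have [measurable]: "(\<lambda>X. X i) \<in> borel_measurable (sample_law n A)" if "i < n" for i
  proof -
    have "(\<lambda>X. X i) \<in> measurable (PiM {..<n} (\<lambda>_. mvnormal_prec A)) (mvnormal_prec A)"
      using that by (intro measurable_component_singleton) simp
    then show ?thesis
      unfolding sample_law_def by (simp cong: measurable_cong_sets)
  qed
  have "(\<lambda>X. (1 / real n) *\<^sub>R (\<Sum>i<n. outer (X i))) \<in> borel_measurable (sample_law n A)"
    by (intro borel_measurable_scaleR borel_measurable_const borel_measurable_sum
        measurable_compose[OF _ borel_measurable_outer]) simp
  then show ?thesis by (simp add: sample_cov_eq_outer[abs_def])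
qed

text \<open>Polarization: four times a product is the difference of the squares along the directions
  with \<open>c = 1\<close> and \<open>c = -1\<close>.\<close>

lemma sample_cov_entry_error:
  fixes A :: "real^'n^'n"
  assumes A: "pos_def_mat A" and n: "n > 0" and t: "t \<ge> 0"
    and dev: "\<And>c. c \<in> {1, -1} \<Longrightarrow>
      \<bar>(\<Sum>i<n. ((axis j 1 + c *\<^sub>R axis k 1) \<bullet> X i)\<^sup>2)
        - real n * ((axis j 1 + c *\<^sub>R axis k 1) \<bullet> (matrix_inv A *v (axis j 1 + c *\<^sub>R axis k 1)))\<bar>
      \<le> real n * ((axis j 1 + c *\<^sub>R axis k 1) \<bullet> (matrix_inv A *v (axis j 1 + c *\<^sub>R axis k 1))) * t"
  shows "\<bar>sample_cov n X $ j $ k - matrix_inv A $ j $ k\<bar> \<le> sigma2_max A * t"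
proof -
  obtain R where R: "transpose R = R" "R ** R = A" "invertible R"
    using pos_def_mat_sqrt[OF A] .
  define G where "G = matrix_inv A"
  have "transpose G = G"
    using matrix_inv_sqrt[OF R] by (simp add: G_def matrix_transpose_mul)
  then have sym: "G $ k $ j = G $ j $ k"
    by (metis (no_types) transpose_def vec_lambda_beta)
  have v: "(axis j 1 + c *\<^sub>R axis k 1) \<bullet> (G *v (axis j 1 + c *\<^sub>R axis k 1))
      = G $ j $ j + 2 * c * G $ j $ k + c\<^sup>2 * G $ k $ k" for c
    using sym
    by (simp add: matrix_vector_right_distrib matrix_vector_mult_scaleR inner_add_left inner_add_right
        mat_nth_eq_inner[symmetric] power2_eq_square algebra_simps)
  have u: "(axis j 1 + c *\<^sub>R axis k 1) \<bullet> x = x $ j + c * x $ k" for c and x :: "real^'n"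
    by (simp add: inner_add_left inner_axis')
  define Sp where "Sp = (\<Sum>i<n. (X i $ j + X i $ k)\<^sup>2)"
  define Sm where "Sm = (\<Sum>i<n. (X i $ j - X i $ k)\<^sup>2)"
  define vp where "vp = G $ j $ j + 2 * G $ j $ k + G $ k $ k"
  define vm where "vm = G $ j $ j - 2 * G $ j $ k + G $ k $ k"
  have p: "\<bar>Sp - real n * vp\<bar> \<le> real n * vp * t"
    using dev[of 1] unfolding G_def[symmetric] v unfolding u by (simp add: Sp_def vp_def)
  have m: "\<bar>Sm - real n * vm\<bar> \<le> real n * vm * t"
    using dev[of "-1"] unfolding G_def[symmetric] v unfolding u by (simp add: Sm_def vm_def)
  have "Sp - Sm = (\<Sum>i<n. 4 * (X i $ j * X i $ k))"
    unfolding Sp_def Sm_def sum_subtractf[symmetric]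
    by (intro sum.cong) (auto simp: power2_eq_square algebra_simps)
  then have S: "sample_cov n X $ j $ k = (Sp - Sm) / (4 * real n)"
    by (simp add: sample_cov_def sum_distrib_left[symmetric])
  have "sample_cov n X $ j $ k - G $ j $ k = ((Sp - real n * vp) - (Sm - real n * vm)) / (4 * real n)"
    unfolding S vp_def vm_def using n by (simp add: field_simps)
  then have "\<bar>sample_cov n X $ j $ k - G $ j $ k\<bar> = \<bar>(Sp - real n * vp) - (Sm - real n * vm)\<bar> / (4 * real n)"
    using n by (simp add: abs_divide)
  also have "\<dots> \<le> (real n * vp * t + real n * vm * t) / (4 * real n)"
    using n p m by (intro divide_right_mono) linarith+
  \<comment> \<open>In \<open>vp + vm\<close> the off-diagonal terms cancel, so the error is
    governed by diagonal entries of the covariance alone.\<close>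
  also have "\<dots> = (G $ j $ j + G $ k $ k) / 2 * t"
    using n by (simp add: vp_def vm_def field_simps)
  also have "\<dots> \<le> sigma2_max A * t"
    using sigma2_max_ge[of A j] sigma2_max_ge[of A k]
    by (intro mult_right_mono t) (simp add: G_def)
  finally show ?thesis by (simp add: G_def)
qed

text \<open>Of the exponential, \<open>p powr (- e)\<close> is kept and the remaining
  \<open>1 / p ^ 5\<close> absorbs the union factor \<open>4 * p\<^sup>2\<close>; it then suffices
  that \<open>sqrt (pi * ln p) \<le> p ^ 3 / 4\<close>, which holds from \<open>p = 2\<close>
  on.\<close>

lemma failure_probability_le:
  fixes p e :: real
  assumes p: "p \<ge> 2" and e: "e > 0"
  shows "4 * p\<^sup>2 * exp (- (5 * (1 + e / 2) * ln p)) \<le> 1 / sqrt (pi * ln p) * p powr (- e)"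
proof -
  have lnp: "ln p > 0" using p by simp
  have "exp (- (5 * (1 + e / 2) * ln p)) \<le> exp (- (5 * ln p)) * exp (- (e * ln p))"
    unfolding exp_add[symmetric] using e lnp by (simp add: algebra_simps)
  also have "exp (- (5 * ln p)) = 1 / p ^ 5"
    using p by (simp add: exp_minus inverse_eq_divide exp_of_nat_mult[of 5 "ln p", simplified])
  also have "exp (- (e * ln p)) = p powr (- e)" using p by (simp add: powr_def)
  finally have 1: "4 * p\<^sup>2 * exp (- (5 * (1 + e / 2) * ln p)) \<le> 4 * p\<^sup>2 * (1 / p ^ 5 * p powr (- e))"
    by (intro mult_left_mono) auto
  have 2: "4 * p\<^sup>2 * (1 / p ^ 5 * p powr (- e)) = 4 / p ^ 3 * p powr (- e)"
    using p by (simp add: field_simps power_numeral_reduce)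
  have "sqrt (pi * ln p) \<le> p ^ 3 / 4"
  proof (rule real_le_lsqrt)
    have "pi * ln p \<le> 4 * (p - 1)"
      using pi_less_4 ln_le_minus_one[of p] lnp p by (intro mult_mono) auto
    also have "\<dots> \<le> p\<^sup>2"
      using zero_le_power2[of "p - 2"] by (simp add: power2_eq_square algebra_simps)
    also have "\<dots> \<le> p\<^sup>2 * (p ^ 4 / 16)"
      using power_mono[of 2 p 4] mult_left_mono[of 1 "p ^ 4 / 16" "p\<^sup>2"] p by simp
    also have "\<dots> = (p ^ 3 / 4)\<^sup>2" by (simp add: power_numeral_reduce)
    finally show "pi * ln p \<le> (p ^ 3 / 4)\<^sup>2" .
  qed (use p lnp in auto)
  then have "1 / (p ^ 3 / 4) \<le> 1 / sqrt (pi * ln p)"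
    using lnp p by (intro divide_left_mono mult_pos_pos) auto
  then have 3: "4 / p ^ 3 * p powr (- e) \<le> 1 / sqrt (pi * ln p) * p powr (- e)"
    by (intro mult_right_mono) auto
  from 1 3 show ?thesis unfolding 2 by (rule order_trans)
qed

text \<open>Union bound over \<open>2 * p\<^sup>2\<close> directions, each costing two tails, where
  \<open>p\<close> is the number of nodes.\<close>

lemma sample_cov_max_error:
  fixes A :: "real^'n^'n"
  assumes A: "pos_def_mat A" and n: "n > 0" and t: "0 < t" "t \<le> 1"
  obtains G where "G \<in> sets (sample_law n A)"
    "1 - 4 * (real CARD('n))\<^sup>2 * exp (- (real n * t\<^sup>2 / 8)) \<le> measure (sample_law n A) G"
    "\<And>X j k. X \<in> G \<Longrightarrow> \<bar>sample_cov n X $ j $ k - matrix_inv A $ j $ k\<bar> \<le> sigma2_max A * t"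
proof -
  let ?P = "sample_law n A"
  interpret P: prob_space ?P by (rule prob_space_sample_law[OF A])
  \<comment> \<open>The Boolean selects the sign. Pairs with \<open>j = k\<close> are included; the
    zero direction arising from them is harmless.\<close>
  define u :: "'n \<times> 'n \<times> bool \<Rightarrow> real^'n" where
    "u = (\<lambda>(j, k, b). axis j 1 + (if b then 1 else -1) *\<^sub>R axis k 1)"
  define v where "v i = u i \<bullet> (matrix_inv A *v u i)" for i
  define bad where "bad i = {X \<in> space ?P. \<not> \<bar>(\<Sum>l<n. (u i \<bullet> X l)\<^sup>2) - real n * v i\<bar> \<le> real n * v i * t}" for i
  have bad_meas: "bad i \<in> sets ?P" for i
  proof -
    have [measurable]: "(\<lambda>X. \<Sum>l<n. (u i \<bullet> X l)\<^sup>2) \<in> borel_measurable ?P"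
      unfolding sample_law_def by measurable
    show ?thesis unfolding bad_def by measurable
  qed
  let ?B = "\<Union>i. bad i"
  have B: "?B \<in> sets ?P" using bad_meas by (intro sets.finite_UN) auto
  have "measure ?P ?B \<le> (\<Sum>i\<in>UNIV. measure ?P (bad i))"
    by (rule P.finite_measure_subadditive_finite) (use bad_meas in auto)
  also have "\<dots> \<le> (\<Sum>i\<in>(UNIV :: ('n \<times> 'n \<times> bool) set). 2 * exp (- (real n * t\<^sup>2 / 8)))"
    unfolding bad_def v_def by (intro sum_mono sample_law_square_sum_concentration A t)
  also have "\<dots> = 4 * (real CARD('n))\<^sup>2 * exp (- (real n * t\<^sup>2 / 8))"
    by (simp add: power2_eq_square)
  finally have "1 - 4 * (real CARD('n))\<^sup>2 * exp (- (real n * t\<^sup>2 / 8)) \<le> measure ?P (space ?P - ?B)"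
    using P.prob_compl[OF B] by simp
  moreover have "\<bar>sample_cov n X $ j $ k - matrix_inv A $ j $ k\<bar> \<le> sigma2_max A * t"
    if X: "X \<in> space ?P - ?B" for X j k
  proof (rule sample_cov_entry_error[OF A n])
    fix c :: real assume "c \<in> {1, -1}"
    then obtain b where c: "c = (if b then 1 else -1)" by (metis empty_iff insert_iff)
    then have "u (j, k, b) = axis j 1 + c *\<^sub>R axis k 1" by (simp add: u_def)
    moreover have "X \<notin> bad (j, k, b)" using X by auto
    ultimately show "\<bar>(\<Sum>i<n. ((axis j 1 + c *\<^sub>R axis k 1) \<bullet> X i)\<^sup>2)
        - real n * ((axis j 1 + c *\<^sub>R axis k 1) \<bullet> (matrix_inv A *v (axis j 1 + c *\<^sub>R axis k 1)))\<bar>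
      \<le> real n * ((axis j 1 + c *\<^sub>R axis k 1) \<bullet> (matrix_inv A *v (axis j 1 + c *\<^sub>R axis k 1))) * t"
      using X unfolding bad_def v_def by auto
  qed (use t in simp)
  ultimately show ?thesis using that[of "space ?P - ?B"] B by auto
qed

theorem theorem3:
  fixes n p q :: nat and gamma eps1 C :: real
    and E0 :: "'n::finite set set" and Theta0 :: "real^'n^'n"
  assumes "n > 0" and "q > 0" and "p = CARD('n)" and "p \<ge> 2"
    and "eps1 > 0"
    and "edge_set E0"
    and "pos_def_mat Theta0"
    and "\<And>j k. Theta0 $ j $ k \<noteq> 0 \<longleftrightarrow> (j = k \<or> {j, k} \<in> E0)"
    and "C \<ge> sigma2_max Theta0 * lambda_max Theta0"
    and "gamma0 = gamma - (1 - 1 / (4 * log (real n) (real p)))"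
    and "((real p + 2 * real q) * ln (real p) / real n)
           * (lambda_max Theta0 ^ 2 / theta_min E0 Theta0 ^ 2)
         \<le> 1 / (3200 * max (1 + gamma0) ((1 + eps1 / 2) * C ^ 2))"
  shows "measure (sample_law n Theta0)
           {X \<in> space (sample_law n Theta0).
              \<forall>E. edge_set E \<and> \<not> (E0 \<subseteq> E) \<and> card E \<le> q \<longrightarrow>
                 ereal (loglik n (sample_cov n X) Theta0) - loglik_mle n (sample_cov n X) E
                   > ereal (2 * real q * ln (real p) * (1 + gamma0))}
         \<ge> 1 - 1 / sqrt (pi * ln (real p)) * real p powr (- eps1)"
    (is "measure ?P ?T \<ge> 1 - ?f")
proof -
  note n = assms(1) and q = assms(2) and p = assms(3) and p2 = assms(4) and e = assms(5)
    and E0 = assms(6) and A = assms(7) and AE0 = assms(8) and C = assms(9) and small = assms(11)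
  interpret P: prob_space ?P by (rule prob_space_sample_law[OF A])
  have lnp: "ln (real p) > 0" using p2 by simp
  show ?thesis
  proof (cases "E0 = {}")
    \<comment> \<open>Every edge set contains the empty one, so the event holds vacuously and has
      probability 1. Past this case \<open>theta_min\<close> is positive.\<close>
    case True
    have "0 \<le> ?f" using lnp by (intro mult_nonneg_nonneg) auto
    then show ?thesis using True P.prob_space by simp
  next
    case False
    let ?l = "lambda_max Theta0" and ?s = "sigma2_max Theta0" and ?t = "theta_min E0 Theta0"
    have l: "?l > 0" by (rule pos_def_lambda_max_pos[OF A])
    have C1: "C \<ge> 1" using C sigma2_max_lambda_max_ge_1[OF A] by linarith
    obtain a b where ab: "{a, b} \<in> E0" "?t = \<bar>Theta0 $ a $ b\<bar>"
      using theta_min_attained[OF E0 False] by metis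
    have t: "?t > 0" "?t \<le> ?l" using ab AE0[of a b] pos_def_entry_le[OF A] by auto
    define y where "y = ?t / ?l"
    have y: "0 < y" "y \<le> 1" using t l by (auto simp: y_def)
    define K where "K = real p + 2 * real q"
    have K: "K \<ge> 4" "K > 2 * real q" using p2 q by (auto simp: K_def)
    define M where "M = max (1 + gamma0) ((1 + eps1 / 2) * C\<^sup>2)"
    have M0: "M > 0" using e C1 by (auto simp: M_def less_max_iff_disj)
    \<comment> \<open>The hypothesis cleared of denominators; its two uses correspond to the two
      arguments of the maximum \<open>M\<close>.\<close>
    have main: "K * ln (real p) * M \<le> real n * y\<^sup>2 / 3200"
    proof -
      have "?l\<^sup>2 / ?t\<^sup>2 = 1 / y\<^sup>2" by (simp add: y_def power_divide)
      then have "K * ln (real p) / real n * (1 / y\<^sup>2) \<le> 1 / (3200 * M)"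
        using small by (simp add: K_def M_def)
      then show ?thesis using n y M0 by (simp add: field_simps)
    qed
    \<comment> \<open>The Chernoff exponent is \<open>n \<tau>\<^sup>2 / 8\<close>; the factor 40 = 5 * 8 leaves \<open>p\<^sup>-\<^sup>5\<close>
      to absorb the union bound.\<close>
    define \<tau> where "\<tau> = sqrt (40 * (1 + eps1 / 2) * ln (real p) / real n)"
    have tau2: "\<tau>\<^sup>2 = 40 * (1 + eps1 / 2) * ln (real p) / real n"
      using e lnp by (simp add: \<tau>_def)
    have tau0: "\<tau> > 0" using e lnp n by (simp add: \<tau>_def)
    \<comment> \<open>The second argument of the maximum is used here, and 3200 = 40 * 80 combines
      the 40 of \<open>\<tau>\<close> with the 80 demanded by the gap bound.\<close>
    have CK: "(C * \<tau>)\<^sup>2 * K \<le> y\<^sup>2 / 80"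
    proof -
      have "K * ln (real p) * ((1 + eps1 / 2) * C\<^sup>2) \<le> K * ln (real p) * M"
        using K lnp by (intro mult_left_mono) (auto simp: M_def)
      also note main
      finally show ?thesis using n by (simp add: power_mult_distrib tau2 field_simps)
    qed
    have tau1: "\<tau> \<le> 1"
    proof -
      have "\<tau>\<^sup>2 * (1 * 1) \<le> \<tau>\<^sup>2 * (C\<^sup>2 * K)"
        using C1 K by (intro mult_left_mono mult_mono) (auto simp: one_le_power)
      also have "\<dots> \<le> y\<^sup>2 / 80" using CK by (simp add: power_mult_distrib mult_ac)
      also have "\<dots> \<le> 1" using y power_le_one[of y 2] by simp
      finally show ?thesis using tau0 by (simp add: power2_le_iff_abs_le[symmetric] abs_square_le_1)
    qed
    obtain G where G: "G \<in> sets ?P"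
      "1 - 4 * (real p)\<^sup>2 * exp (- (real n * \<tau>\<^sup>2 / 8)) \<le> measure ?P G"
      "\<And>X j k. X \<in> G \<Longrightarrow> \<bar>sample_cov n X $ j $ k - matrix_inv Theta0 $ j $ k\<bar> \<le> ?s * \<tau>"
      using sample_cov_max_error[OF A n tau0 tau1] p by metis
    have "real n * \<tau>\<^sup>2 / 8 = 5 * (1 + eps1 / 2) * ln (real p)" using n by (simp add: tau2)
    then have "1 - ?f \<le> measure ?P G"
      using G(2) failure_probability_le[of "real p" eps1] p2 e by simp
    also have "\<dots> \<le> measure ?P ?T"
    proof (rule P.finite_measure_mono)
      have [measurable]: "sample_cov n \<in> borel_measurable ?P" by (rule sample_cov_measurable)
      \<comment> \<open>There are only finitely many edge sets on the nodes, so the quantifier over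
        \<open>E\<close> preserves measurability.\<close>
      show "?T \<in> sets ?P" by measurable
      show "G \<subseteq> ?T"
      proof
        fix X assume X: "X \<in> G"
        have gap: "real n / 24 * y\<^sup>2 \<le> loglik n (sample_cov n X) Theta0 - loglik n (sample_cov n X) B"
          if "edge_set E" "\<not> E0 \<subseteq> E" "card E \<le> q" "in_model E B" for E B
          unfolding y_def
        proof (rule loglik_diff_ge[OF A E0 AE0 that])
          show "\<bar>sample_cov n X $ j $ k - matrix_inv Theta0 $ j $ k\<bar> \<le> ?s * \<tau>" for j k
            by (rule G(3)[OF X])
          have "?s * \<tau> * ?l \<le> C * \<tau>"
            using mult_right_mono[OF C, of \<tau>] tau0 by (simp add: mult_ac)
          then have "(?s * \<tau> * ?l)\<^sup>2 \<le> (C * \<tau>)\<^sup>2"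
            using sigma2_max_lambda_max_ge_1(2)[OF A] tau0 l by (intro power_mono) auto
          then have "(?s * \<tau> * ?l)\<^sup>2 * K \<le> (C * \<tau>)\<^sup>2 * K"
            using K by (intro mult_right_mono) auto
          then show "(?s * \<tau> * ?l)\<^sup>2 * (real CARD('n) + 2 * real q) \<le> (?t / ?l)\<^sup>2 / 80"
            using CK by (simp add: K_def p y_def)
          show "4 \<le> real CARD('n) + 2 * real q" using K by (simp add: K_def p)
        qed
        \<comment> \<open>Here the first argument of the maximum is used, together with
          \<open>2 * q < K\<close>. Strictness comes from the wide room between 1/3200 and
          1/24.\<close>
        have strict: "2 * real q * ln (real p) * (1 + gamma0) < real n / 24 * y\<^sup>2"
        proof -
          have "2 * real q * ln (real p) * (1 + gamma0) \<le> 2 * real q * ln (real p) * M"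
            using lnp by (intro mult_left_mono) (auto simp: M_def)
          also have "\<dots> \<le> K * ln (real p) * M"
            using lnp M0 K by (intro mult_right_mono) auto
          also note main
          also have "real n * y\<^sup>2 / 3200 < real n / 24 * y\<^sup>2"
            using n y by simp
          finally show ?thesis .
        qed
        have "ereal (2 * real q * ln (real p) * (1 + gamma0))
            < ereal (loglik n (sample_cov n X) Theta0) - loglik_mle n (sample_cov n X) E"
          if E: "edge_set E" "\<not> E0 \<subseteq> E" "card E \<le> q" for E
        proof -
          \<comment> \<open>The gap is uniform over the model, so it survives the supremum, whether
            or not a maximizer exists.\<close>
          have "loglik_mle n (sample_cov n X) E \<le> ereal (loglik n (sample_cov n X) Theta0 - real n / 24 * y\<^sup>2)"
            unfolding loglik_mle_def
          proof (rule SUP_least)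
            fix B assume "B \<in> {B. in_model E B}"
            then show "ereal (loglik n (sample_cov n X) B) \<le> ereal (loglik n (sample_cov n X) Theta0 - real n / 24 * y\<^sup>2)"
              using gap[OF E, of B] by simp
          qed
          then have "ereal (loglik n (sample_cov n X) Theta0) - ereal (loglik n (sample_cov n X) Theta0 - real n / 24 * y\<^sup>2)
              \<le> ereal (loglik n (sample_cov n X) Theta0) - loglik_mle n (sample_cov n X) E"
            by (intro ereal_minus_mono) auto
          then have "ereal (real n / 24 * y\<^sup>2) \<le> ereal (loglik n (sample_cov n X) Theta0) - loglik_mle n (sample_cov n X) E"
            by simp
          then show ?thesis using strict by (meson ereal_less(1) less_ereal.simps(1) less_le_trans)
        qed
        then show "X \<in> ?T" using sets.sets_into_space[OF G(1)] X by auto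
      qed
    qed
    finally show ?thesis .
  qed
qed

end
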